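(* Let $K$ be an algebraically closed field of characteristic zero, $c\ge 4$, and $\mathfrak{g}=M_{2,c}$. Then $$\chi(\mathfrak{g})=\dim\mathfrak{g}-4=2\alpha(\mathfrak{g})-\dim\mathfrak{g}=\frac{c^2-c-4}{2}.$$
   Context: Lower central series: $\mathfrak{h}^1=\mathfrak{h}$, $\mathfrak{h}^{k+1}=[\mathfrak{h},\mathfrak{h}^k]$. $F_g$ is the free Lie algebra over $K$ on $g$ generators, $F_{g,c}=F_g/F_g^{c+1}$, and $M_{g,c}:=F_{g,c}/[F_{g,c}^2,F_{g,c}^2]$. $\alpha(\mathfrak{h})$ is the maximal dimension of an abelian subalgebra; for $\ell\in\mathfrak{h}^*$, $\mathfrak{h}(\ell)=\{y\in\mathfrak{h}\mid\ell([x,y])=0\ \forall x\in\mathfrak{h}\}$ and the index is $\chi(\mathfrak{h})=\min_{\ell\in\mathfrak{h}^*}\dim\mathfrak{h}(\ell)$. (One has $\dim M_{2,c}=(c^2-c+4)/2$.) *)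

theory Defs
  imports "HOL-Computational_Algebra.Polynomial"
begin

definition alg_closed :: "'k::field itself \<Rightarrow> bool" where
  "alg_closed _ \<longleftrightarrow> (\<forall>p :: 'k poly. degree p > 0 \<longrightarrow> (\<exists>x. poly p x = 0))"

record ('k, 'e) lie =
  lcar   :: "'e set"
  ladd   :: "'e \<Rightarrow> 'e \<Rightarrow> 'e"
  lzero  :: "'e"
  lscale :: "'k \<Rightarrow> 'e \<Rightarrow> 'e"
  lbr    :: "'e \<Rightarrow> 'e \<Rightarrow> 'e"

definition lcomb :: "('k, 'e) lie \<Rightarrow> 'k list \<Rightarrow> 'e list \<Rightarrow> 'e" where
  "lcomb L cs vs = foldr (\<lambda>(a, v) acc. ladd L (lscale L a v) acc) (zip cs vs) (lzero L)"

definition lin_indep :: "('k::field, 'e) lie \<Rightarrow> 'e list \<Rightarrow> bool" where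
  "lin_indep L vs \<longleftrightarrow> set vs \<subseteq> lcar L \<and> distinct vs \<and>
     (\<forall>cs. length cs = length vs \<and> lcomb L cs vs = lzero L \<longrightarrow> (\<forall>c\<in>set cs. c = 0))"

definition ldim :: "('k::field, 'e) lie \<Rightarrow> 'e set \<Rightarrow> nat" where
  "ldim L S = (GREATEST n. \<exists>vs. length vs = n \<and> set vs \<subseteq> S \<and> lin_indep L vs)"

definition dim_lie :: "('k::field, 'e) lie \<Rightarrow> nat" where
  "dim_lie L = ldim L (lcar L)"

inductive_set lspan :: "('k, 'e) lie \<Rightarrow> 'e set \<Rightarrow> 'e set" for L S where
  zero: "lzero L \<in> lspan L S"
| base: "x \<in> S \<Longrightarrow> x \<in> lspan L S"
| add: "x \<in> lspan L S \<Longrightarrow> y \<in> lspan L S \<Longrightarrow> ladd L x y \<in> lspan L S"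
| scale: "x \<in> lspan L S \<Longrightarrow> lscale L a x \<in> lspan L S"

definition brsp :: "('k, 'e) lie \<Rightarrow> 'e set \<Rightarrow> 'e set \<Rightarrow> 'e set" where
  "brsp L A B = lspan L {lbr L a b | a b. a \<in> A \<and> b \<in> B}"

fun lcs :: "('k, 'e) lie \<Rightarrow> nat \<Rightarrow> 'e set" where
  "lcs L 0 = lcar L"
| "lcs L (Suc 0) = lcar L"
| "lcs L (Suc (Suc k)) = brsp L (lcar L) (lcs L (Suc k))"

definition coset :: "('k, 'e) lie \<Rightarrow> 'e set \<Rightarrow> 'e \<Rightarrow> 'e set" where
  "coset L I u = {v \<in> lcar L. \<exists>i\<in>I. v = ladd L u i}"

definition rep :: "'e set \<Rightarrow> 'e" where
  "rep C = (SOME u. u \<in> C)"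

definition quot :: "('k, 'e) lie \<Rightarrow> 'e set \<Rightarrow> ('k, 'e set) lie" where
  "quot L I = \<lparr> lcar = coset L I ` lcar L,
      ladd = (\<lambda>C D. coset L I (ladd L (rep C) (rep D))),
      lzero = coset L I (lzero L),
      lscale = (\<lambda>a C. coset L I (lscale L a (rep C))),
      lbr = (\<lambda>C D. coset L I (lbr L (rep C) (rep D))) \<rparr>"

definition lin_fun :: "('k::field, 'e) lie \<Rightarrow> ('e \<Rightarrow> 'k) \<Rightarrow> bool" where
  "lin_fun L l \<longleftrightarrow> (\<forall>u\<in>lcar L. \<forall>v\<in>lcar L. l (ladd L u v) = l u + l v) \<and>
                    (\<forall>a. \<forall>u\<in>lcar L. l (lscale L a u) = a * l u)"

definition stab :: "('k::field, 'e) lie \<Rightarrow> ('e \<Rightarrow> 'k) \<Rightarrow> 'e set" where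
  "stab L l = {y \<in> lcar L. \<forall>x\<in>lcar L. l (lbr L x y) = 0}"

definition lie_index :: "('k::field, 'e) lie \<Rightarrow> nat" where
  "lie_index L = (LEAST d. \<exists>l. lin_fun L l \<and> d = ldim L (stab L l))"

definition abelian_subalg :: "('k::field, 'e) lie \<Rightarrow> 'e set \<Rightarrow> bool" where
  "abelian_subalg L A \<longleftrightarrow> A \<subseteq> lcar L \<and> lzero L \<in> A \<and>
     (\<forall>x\<in>A. \<forall>y\<in>A. ladd L x y \<in> A) \<and> (\<forall>a. \<forall>x\<in>A. lscale L a x \<in> A) \<and>
     (\<forall>x\<in>A. \<forall>y\<in>A. lbr L x y = lzero L)"

definition alpha :: "('k::field, 'e) lie \<Rightarrow> nat" where
  "alpha L = (GREATEST d. \<exists>A. abelian_subalg L A \<and> d = ldim L A)"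

section \<open>Free Lie algebra on g generators, inside the free associative algebra\<close>

text \<open>Noncommutative polynomials over 'k in letters 0..g-1: coefficient functions on words.\<close>
type_synonym 'k ncpoly = "nat list \<Rightarrow> 'k"

definition ncmul :: "'k::field ncpoly \<Rightarrow> 'k ncpoly \<Rightarrow> 'k ncpoly" where
  "ncmul f h = (\<lambda>w. \<Sum>i\<le>length w. f (take i w) * h (drop i w))"

definition ncbr :: "'k::field ncpoly \<Rightarrow> 'k ncpoly \<Rightarrow> 'k ncpoly" where
  "ncbr f h = (\<lambda>w. ncmul f h w - ncmul h f w)"

definition gen :: "nat \<Rightarrow> 'k::field ncpoly" where
  "gen i = (\<lambda>w. if w = [i] then 1 else 0)"

inductive_set freeLie_set :: "nat \<Rightarrow> 'k::field ncpoly set" for g where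
  gen: "i < g \<Longrightarrow> gen i \<in> freeLie_set g"
| zero: "(\<lambda>_. 0) \<in> freeLie_set g"
| add: "f \<in> freeLie_set g \<Longrightarrow> h \<in> freeLie_set g \<Longrightarrow> (\<lambda>w. f w + h w) \<in> freeLie_set g"
| scale: "f \<in> freeLie_set g \<Longrightarrow> (\<lambda>w. a * f w) \<in> freeLie_set g"
| br: "f \<in> freeLie_set g \<Longrightarrow> h \<in> freeLie_set g \<Longrightarrow> ncbr f h \<in> freeLie_set g"

definition F :: "nat \<Rightarrow> ('k::field, 'k ncpoly) lie" where
  "F g = \<lparr> lcar = freeLie_set g, ladd = (\<lambda>f h w. f w + h w), lzero = (\<lambda>_. 0),
           lscale = (\<lambda>a f w. a * f w), lbr = ncbr \<rparr>"

definition Fgc :: "nat \<Rightarrow> nat \<Rightarrow> ('k::field, 'k ncpoly set) lie" where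
  "Fgc g c = quot (F g) (lcs (F g) (c + 1))"

definition Mgc :: "nat \<Rightarrow> nat \<Rightarrow> ('k::field, 'k ncpoly set set) lie" where
  "Mgc g c = quot (Fgc g c) (brsp (Fgc g c) (lcs (Fgc g c) 2) (lcs (Fgc g c) 2))"

end

theory Submission
  imports Defs "HOL-Library.Function_Algebras"
begin

text \<open>
  The commutator ideal of the free metabelian Lie algebra on x, y is a free module of rank one
  over polynomials in ad x and ad y, generated by [x, y]. Hence the algebra has basis x, y and
  e_ij = (ad x)^(i-1) (ad y)^(j-1) [x, y] with i, j >= 1 and i + j <= c; independence of this
  spanning set is seen by the abelianised Fox derivative with respect to y.
  The commutator ideal is abelian of codimension 2, so every form (u, v) \<mapsto> l([u, v]) has
  rank at most 4, and for c >= 4 the functional dual to e_31 + e_13 attains rank 4. An abelian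
  subalgebra not contained in the commutator ideal satisfies two independent linear equations,
  obtained from the brackets with one element outside that ideal.
\<close>

section \<open>Lie algebras, quotients and ideals\<close>

text \<open>Why one Fox derivative suffices: write a Lie element as f = f_x x + f_y y in the free
  associative algebra. For f in the commutator ideal the abelianised coefficients satisfy f_x X +
  f_y Y = 0, so f_y determines f_x. On that ideal ad x and ad y multiply f_y by X and Y, and [x, y]
  = xy - yx has f_y = X. Hence e_ij becomes X^i Y^(j-1), and distinct monomials are independent. A
  bracket of two commutators goes to 0 because both factors abelianise to 0, so with degrees above c
  cut off the derivative survives both quotients. The obstacle is the carrier: cosets of cosets,
  with operations defined through chosen representatives. Hence everything is moved to coordinate
  functions on pairs (i, j), where dimensions can be counted. The 4 is 2 + 2: the codimension of the
  commutator ideal, and the two equations l([x, v]) = l([y, v]) = 0 inside it. Rank 4 needs degree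
  4: for c = 3 only x, y and e_11 survive modulo the centre, so an alternating form (u, v) \<mapsto>
  l([u, v]) has rank at most 2.\<close>

locale lie_alg =
  fixes L :: "('k::field, 'e) lie"
  assumes add_closed: "u \<in> lcar L \<Longrightarrow> v \<in> lcar L \<Longrightarrow> ladd L u v \<in> lcar L"
    and zero_closed: "lzero L \<in> lcar L"
    and scale_closed: "u \<in> lcar L \<Longrightarrow> lscale L a u \<in> lcar L"
    and br_closed: "u \<in> lcar L \<Longrightarrow> v \<in> lcar L \<Longrightarrow> lbr L u v \<in> lcar L"
    and add_assoc: "u \<in> lcar L \<Longrightarrow> v \<in> lcar L \<Longrightarrow> w \<in> lcar L \<Longrightarrow>
          ladd L (ladd L u v) w = ladd L u (ladd L v w)"
    and add_comm: "u \<in> lcar L \<Longrightarrow> v \<in> lcar L \<Longrightarrow> ladd L u v = ladd L v u"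
    and zero_add: "u \<in> lcar L \<Longrightarrow> ladd L (lzero L) u = u"
    and scale_add: "u \<in> lcar L \<Longrightarrow> v \<in> lcar L \<Longrightarrow>
          lscale L a (ladd L u v) = ladd L (lscale L a u) (lscale L a v)"
    and add_scale: "u \<in> lcar L \<Longrightarrow> lscale L (a + b) u = ladd L (lscale L a u) (lscale L b u)"
    and scale_scale: "u \<in> lcar L \<Longrightarrow> lscale L a (lscale L b u) = lscale L (a * b) u"
    and scale_one: "u \<in> lcar L \<Longrightarrow> lscale L 1 u = u"
    and scale_0: "u \<in> lcar L \<Longrightarrow> lscale L 0 u = lzero L"
    and br_add: "u \<in> lcar L \<Longrightarrow> v \<in> lcar L \<Longrightarrow> w \<in> lcar L \<Longrightarrow>
          lbr L u (ladd L v w) = ladd L (lbr L u v) (lbr L u w)"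
    and add_br: "u \<in> lcar L \<Longrightarrow> v \<in> lcar L \<Longrightarrow> w \<in> lcar L \<Longrightarrow>
          lbr L (ladd L u v) w = ladd L (lbr L u w) (lbr L v w)"
    and br_scale: "u \<in> lcar L \<Longrightarrow> v \<in> lcar L \<Longrightarrow> lbr L u (lscale L a v) = lscale L a (lbr L u v)"
    and scale_br: "u \<in> lcar L \<Longrightarrow> v \<in> lcar L \<Longrightarrow> lbr L (lscale L a u) v = lscale L a (lbr L u v)"
    and br_self: "u \<in> lcar L \<Longrightarrow> lbr L u u = lzero L"
    and leibniz: "u \<in> lcar L \<Longrightarrow> v \<in> lcar L \<Longrightarrow> w \<in> lcar L \<Longrightarrow>
          lbr L u (lbr L v w) = ladd L (lbr L (lbr L u v) w) (lbr L v (lbr L u w))"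
begin

lemmas closed = add_closed zero_closed scale_closed br_closed

lemma add_zero: "u \<in> lcar L \<Longrightarrow> ladd L u (lzero L) = u"
  using zero_add add_comm zero_closed by metis

lemma add_neg: "u \<in> lcar L \<Longrightarrow> ladd L u (lscale L (-1) u) = lzero L"
  using add_scale[of u 1 "-1"] by (simp add: scale_one scale_0)

lemma scale_zero: "lscale L a (lzero L) = lzero L"
  using scale_scale[OF zero_closed, of a 0] scale_0[OF zero_closed] by simp

lemma br_zero: "u \<in> lcar L \<Longrightarrow> lbr L u (lzero L) = lzero L"
  using br_scale[of u "lzero L" 0] by (simp add: scale_0 closed)

lemma zero_br: "u \<in> lcar L \<Longrightarrow> lbr L (lzero L) u = lzero L"
  using scale_br[of "lzero L" u 0] by (simp add: scale_0 closed)

lemma br_anti: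
  assumes "u \<in> lcar L" "v \<in> lcar L"
  shows "lbr L u v = lscale L (-1) (lbr L v u)"
proof -
  let ?n = "lscale L (-1) (lbr L v u)"
  have "lzero L = lbr L (ladd L u v) (ladd L u v)"
    using assms by (simp add: br_self closed)
  also have "\<dots> = ladd L (lbr L u (ladd L u v)) (lbr L v (ladd L u v))"
    using assms by (intro add_br closed)
  also have "\<dots> = ladd L (lbr L u v) (lbr L v u)"
    using assms by (simp add: br_add br_self closed add_zero zero_add)
  finally have "ladd L (ladd L (lbr L u v) (lbr L v u)) ?n = ?n"
    using assms by (metis zero_add scale_closed br_closed)
  then have "?n = ladd L (ladd L (lbr L u v) (lbr L v u)) ?n" ..
  also have "\<dots> = lbr L u v"
    using assms by (simp add: add_assoc closed add_neg add_zero)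
  finally show ?thesis by simp
qed

lemma add_add_swap:
  assumes "u \<in> lcar L" "v \<in> lcar L" "s \<in> lcar L" "t \<in> lcar L"
  shows "ladd L (ladd L u s) (ladd L v t) = ladd L (ladd L u v) (ladd L s t)"
  using assms by (metis add_assoc add_comm add_closed)

lemma lcomb_closed: "set vs \<subseteq> lcar L \<Longrightarrow> lcomb L cs vs \<in> lcar L"
  unfolding lcomb_def
  by (induction cs vs rule: list_induct2') (auto intro: closed)

text \<open>Coefficients are functions on an index list, so that pointwise sums of them make sense;
  \<open>zip\<close> cuts all three combinations at the same place.\<close>

lemma lcomb_add:
  assumes "set vs \<subseteq> lcar L"
  shows "lcomb L (map (\<lambda>p. f p + g p) ps) vs = ladd L (lcomb L (map f ps) vs) (lcomb L (map g ps) vs)"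
  using assms
proof (induction ps vs rule: list_induct2')
  case (4 p ps v vs)
  have c: "lcomb L (map f ps) vs \<in> lcar L" "lcomb L (map g ps) vs \<in> lcar L" "v \<in> lcar L"
    using 4 by (auto intro: lcomb_closed)
  then show ?case
    using 4 by (simp add: lcomb_def add_scale add_add_swap closed)
qed (auto simp: lcomb_def zero_add zero_closed)

lemma lcomb_scale:
  assumes "set vs \<subseteq> lcar L"
  shows "lcomb L (map (\<lambda>p. a * f p) ps) vs = lscale L a (lcomb L (map f ps) vs)"
  using assms
proof (induction ps vs rule: list_induct2')
  case (4 p ps v vs)
  have c: "lcomb L (map f ps) vs \<in> lcar L" "v \<in> lcar L"
    using 4 by (auto intro: lcomb_closed)
  then show ?case
    using 4 by (simp add: lcomb_def scale_scale scale_add closed)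
qed (auto simp: lcomb_def scale_zero)

lemma lcomb_zero:
  assumes "e ` set ps \<subseteq> lcar L" "\<forall>p\<in>set ps. f p = 0"
  shows "lcomb L (map f ps) (map e ps) = lzero L"
  using assms by (induction ps) (auto simp: lcomb_def scale_0 zero_add zero_closed)

lemma lcomb_single:
  assumes "e ` set ps \<subseteq> lcar L" "distinct ps" "p \<in> set ps"
  shows "lcomb L (map (\<lambda>q. if q = p then 1 else 0) ps) (map e ps) = e p"
  using assms
proof (induction ps)
  case (Cons q qs)
  let ?f = "\<lambda>q. if q = p then 1 else (0::'k)"
  have e: "lcomb L (map ?f (q # qs)) (map e (q # qs))
      = ladd L (lscale L (?f q) (e q)) (lcomb L (map ?f qs) (map e qs))"
    by (simp add: lcomb_def)
  show ?case
  proof (cases "q = p")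
    case True
    then have "lcomb L (map ?f qs) (map e qs) = lzero L"
      using Cons by (intro lcomb_zero) auto
    then show ?thesis
      using e True Cons by (simp add: scale_one add_zero)
  next
    case False
    then have "lcomb L (map ?f qs) (map e qs) = e p"
      using Cons by auto
    then show ?thesis
      using e False Cons by (auto simp: scale_0 zero_add)
  qed
qed simp

end

definition lie_epi :: "('k, 'e) lie \<Rightarrow> ('k, 'f) lie \<Rightarrow> ('e \<Rightarrow> 'f) \<Rightarrow> bool" where
  "lie_epi L M \<pi> \<longleftrightarrow> lcar M = \<pi> ` lcar L \<and> lzero M = \<pi> (lzero L) \<and>
     (\<forall>u\<in>lcar L. \<forall>v\<in>lcar L. ladd M (\<pi> u) (\<pi> v) = \<pi> (ladd L u v)) \<and>
     (\<forall>a. \<forall>u\<in>lcar L. lscale M a (\<pi> u) = \<pi> (lscale L a u)) \<and>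
     (\<forall>u\<in>lcar L. \<forall>v\<in>lcar L. lbr M (\<pi> u) (\<pi> v) = \<pi> (lbr L u v))"

text \<open>Every axiom of \<open>lie_alg\<close> is a closure condition or an identity on the
  carrier, and both pass to surjective images. Quotients are therefore Lie algebras as soon as the
  projection is a \<open>lie_epi\<close>.\<close>

lemma lie_epi_lie_alg:
  assumes "lie_alg L" "lie_epi L M \<pi>"
  shows "lie_alg M"
proof -
  interpret lie_alg L by fact
  have c: "lcar M = \<pi> ` lcar L" and z: "lzero M = \<pi> (lzero L)"
    and o: "\<And>u v. u \<in> lcar L \<Longrightarrow> v \<in> lcar L \<Longrightarrow> ladd M (\<pi> u) (\<pi> v) = \<pi> (ladd L u v)"
    "\<And>a u. u \<in> lcar L \<Longrightarrow> lscale M a (\<pi> u) = \<pi> (lscale L a u)"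
    "\<And>u v. u \<in> lcar L \<Longrightarrow> v \<in> lcar L \<Longrightarrow> lbr M (\<pi> u) (\<pi> v) = \<pi> (lbr L u v)"
    using assms(2) unfolding lie_epi_def by blast+
  show ?thesis
    apply (unfold_locales; (unfold c z)?; (elim imageE)?; hypsubst?; (simp only: o closed imageI)?;
        (rule arg_cong[of _ _ \<pi>])?)
    apply (simp_all only: add_assoc zero_add scale_add add_scale scale_scale scale_one
          scale_0 br_add add_br br_scale scale_br br_self closed)
    apply (rule add_comm; assumption)
    apply (rule leibniz; assumption)
    done
qed

lemma lie_epi_comp:
  assumes "lie_alg L" "lie_epi L M \<pi>" "lie_epi M N \<rho>"
  shows "lie_epi L N (\<lambda>u. \<rho> (\<pi> u))"
  using assms unfolding lie_epi_def by (auto simp: image_image)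

text \<open>Absorption is asked on one side only; antisymmetry supplies the other in
  \<open>ideal_br\<close>.\<close>

definition lie_ideal :: "('k, 'e) lie \<Rightarrow> 'e set \<Rightarrow> bool" where
  "lie_ideal L I \<longleftrightarrow> I \<subseteq> lcar L \<and> lzero L \<in> I \<and> (\<forall>u\<in>I. \<forall>v\<in>I. ladd L u v \<in> I) \<and>
     (\<forall>a. \<forall>u\<in>I. lscale L a u \<in> I) \<and> (\<forall>u\<in>lcar L. \<forall>v\<in>I. lbr L u v \<in> I)"

locale lie_alg_ideal = lie_alg +
  fixes I
  assumes ideal: "lie_ideal L I"
begin

lemma ideal_simps:
  "u \<in> I \<Longrightarrow> u \<in> lcar L" "lzero L \<in> I" "u \<in> I \<Longrightarrow> v \<in> I \<Longrightarrow> ladd L u v \<in> I"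
  "u \<in> I \<Longrightarrow> lscale L a u \<in> I" "w \<in> lcar L \<Longrightarrow> u \<in> I \<Longrightarrow> lbr L w u \<in> I"
  using ideal unfolding lie_ideal_def by blast+

lemma ideal_br: "w \<in> lcar L \<Longrightarrow> u \<in> I \<Longrightarrow> lbr L u w \<in> I"
  using br_anti[of u w] by (simp add: ideal_simps)

lemma coset_absorb:
  assumes "u \<in> lcar L" "i \<in> I"
  shows "coset L I (ladd L u i) = coset L I u"
proof -
  have i: "i \<in> lcar L" using assms ideal_simps by blast
  have "\<exists>k\<in>I. ladd L (ladd L u i) j = ladd L u k" if "j \<in> I" for j
    using that assms i ideal_simps add_assoc by metis
  moreover have "\<exists>k\<in>I. ladd L u j = ladd L (ladd L u i) k" if j: "j \<in> I" for j
  proof -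
    have jc: "j \<in> lcar L" "lscale L (-1) i \<in> lcar L" using j i ideal_simps closed by auto
    have "ladd L (ladd L u i) (ladd L (lscale L (-1) i) j)
        = ladd L u (ladd L (ladd L i (lscale L (-1) i)) j)"
      using assms i jc by (simp add: add_assoc closed)
    also have "\<dots> = ladd L u j" using i jc by (simp add: add_neg zero_add)
    finally show ?thesis using j assms ideal_simps by metis
  qed
  ultimately show ?thesis
    unfolding coset_def by auto
qed

text \<open>All that is known of the chosen representative of a class is that it differs from u by
  an element of I. Every evaluation of a quotient operation starts from this.\<close>

lemma rep_coset:
  assumes "u \<in> lcar L"
  obtains i where "i \<in> I" "i \<in> lcar L" "rep (coset L I u) = ladd L u i"
proof -
  have "u \<in> coset L I u"
    using assms ideal_simps(2) add_zero[OF assms] by (force simp: coset_def)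
  then have "rep (coset L I u) \<in> coset L I u"
    unfolding rep_def by (rule someI)
  then show ?thesis using that ideal_simps(1) by (auto simp: coset_def)
qed

lemma coset_ideal: "i \<in> I \<Longrightarrow> coset L I i = coset L I (lzero L)"
  using coset_absorb[OF zero_closed, of i] by (simp add: zero_add ideal_simps)

text \<open>This is the independence of the chosen representatives: replacing u, v by u + i, v + j
  changes each operation by an element of I, which \<open>coset_absorb\<close> removes.\<close>

lemma quot_epi: "lie_epi L (quot L I) (coset L I)"
  unfolding lie_epi_def
proof (intro conjI ballI allI)
  fix u v a assume uv: "u \<in> lcar L" "v \<in> lcar L"
  obtain i where i: "i \<in> I" "i \<in> lcar L" "rep (coset L I u) = ladd L u i"
    using rep_coset[OF uv(1)] .
  obtain j where j: "j \<in> I" "j \<in> lcar L" "rep (coset L I v) = ladd L v j"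
    using rep_coset[OF uv(2)] .
  have "ladd L (ladd L u i) (ladd L v j) = ladd L (ladd L u v) (ladd L i j)"
    using i j uv by (intro add_add_swap)
  then show "ladd (quot L I) (coset L I u) (coset L I v) = coset L I (ladd L u v)"
    using i j uv by (simp add: quot_def coset_absorb closed ideal_simps)
  have "lbr L (ladd L u i) (ladd L v j) = ladd L (lbr L u (ladd L v j)) (lbr L i (ladd L v j))"
    using i j uv by (intro add_br closed)
  moreover have "lbr L u (ladd L v j) = ladd L (lbr L u v) (lbr L u j)"
    using i j uv by (intro br_add)
  ultimately have "coset L I (lbr L (ladd L u i) (ladd L v j)) = coset L I (lbr L u v)"
    using i j uv by (simp only: coset_absorb closed ideal_simps ideal_br)
  then show "lbr (quot L I) (coset L I u) (coset L I v) = coset L I (lbr L u v)"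
    using i j uv by (simp add: quot_def)
next
  fix u a assume u: "u \<in> lcar L"
  obtain i where i: "i \<in> I" "i \<in> lcar L" "rep (coset L I u) = ladd L u i"
    using rep_coset[OF u] .
  show "lscale (quot L I) a (coset L I u) = coset L I (lscale L a u)"
    using i u by (simp add: quot_def scale_add coset_absorb closed ideal_simps)
qed (simp_all add: quot_def)

text \<open>An additive map that kills I descends to the quotient by evaluation at representatives.
  The coordinates pass through both quotients in this way.\<close>

lemma rep_factor:
  assumes "\<And>u v. u \<in> lcar L \<Longrightarrow> v \<in> lcar L \<Longrightarrow> \<phi> (ladd L u v) = \<phi> u + (\<phi> v :: 'z::group_add)"
    and "\<And>i. i \<in> I \<Longrightarrow> \<phi> i = 0" and "u \<in> lcar L"
  shows "\<phi> (rep (coset L I u)) = \<phi> u"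
proof -
  obtain i where "i \<in> I" "i \<in> lcar L" "rep (coset L I u) = ladd L u i"
    using rep_coset[OF assms(3)] .
  then show ?thesis using assms by simp
qed

end

section \<open>Lower central series and ideals spanned by brackets\<close>

context lie_alg
begin

lemma lspan_subset:
  assumes "S \<subseteq> lcar L"
  shows "lspan L S \<subseteq> lcar L"
proof
  fix u assume "u \<in> lspan L S"
  then show "u \<in> lcar L" by induction (use assms in \<open>auto intro: closed\<close>)
qed

lemma brsp_subset: "A \<subseteq> lcar L \<Longrightarrow> B \<subseteq> lcar L \<Longrightarrow> brsp L A B \<subseteq> lcar L"
  unfolding brsp_def by (rule lspan_subset) (auto intro: closed)

lemma br_mem_brsp: "a \<in> A \<Longrightarrow> b \<in> B \<Longrightarrow> lbr L a b \<in> brsp L A B"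
  unfolding brsp_def by (rule lspan.base) blast

lemma brsp_mono:
  assumes "B \<subseteq> C"
  shows "brsp L A B \<subseteq> brsp L A C"
proof
  fix u assume "u \<in> brsp L A B"
  then show "u \<in> brsp L A C"
    unfolding brsp_def by induction (use assms in \<open>auto intro: lspan.intros\<close>)
qed

lemma lcs_subset: "lcs L k \<subseteq> lcar L"
proof (cases k)
  case (Suc m)
  have "lcs L (Suc m) \<subseteq> lcar L"
    by (induction m) (simp_all add: brsp_subset)
  then show ?thesis using Suc by simp
qed simp

lemma lcs_Suc_subset: "lcs L (Suc (Suc k)) \<subseteq> lcs L (Suc k)"
proof (induction k)
  case 0
  show ?case using lcs_subset[of "Suc (Suc 0)"] by simp
next
  case (Suc k)
  then show ?case using brsp_mono by simp
qed

lemma lie_ideal_lcs: "lie_ideal L (lcs L (Suc k))"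
proof (cases k)
  case 0
  then show ?thesis by (auto simp: lie_ideal_def closed)
next
  case (Suc m)
  have "lbr L u v \<in> lcs L (Suc k)" if "u \<in> lcar L" "v \<in> lcs L (Suc k)" for u v
  proof -
    have "lbr L u v \<in> lcs L (Suc (Suc k))" using that by (simp add: br_mem_brsp)
    then show ?thesis using lcs_Suc_subset by blast
  qed
  moreover have "\<And>u v a. u \<in> lcs L (Suc k) \<Longrightarrow> v \<in> lcs L (Suc k) \<Longrightarrow> ladd L u v \<in> lcs L (Suc k)"
    "\<And>u a. u \<in> lcs L (Suc k) \<Longrightarrow> lscale L a u \<in> lcs L (Suc k)" "lzero L \<in> lcs L (Suc k)"
    using Suc by (auto simp: brsp_def intro: lspan.intros)
  ultimately show ?thesis using lcs_subset unfolding lie_ideal_def by blast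
qed

text \<open>On the spanning brackets this is the Leibniz rule [u, [a, b]] = [[u, a], b] + [a,
  [u, b]]; linearity does the rest.\<close>

lemma lie_ideal_brsp:
  assumes A: "lie_ideal L A"
  shows "lie_ideal L (brsp L A A)"
proof -
  have AL: "A \<subseteq> lcar L" and Abr: "\<And>u a. u \<in> lcar L \<Longrightarrow> a \<in> A \<Longrightarrow> lbr L u a \<in> A"
    using A unfolding lie_ideal_def by blast+
  have "lbr L u v \<in> brsp L A A" if u: "u \<in> lcar L" and v: "v \<in> brsp L A A" for u v
    using v unfolding brsp_def
  proof induction
    case zero
    show ?case using u by (simp add: br_zero lspan.zero)
  next
    case (base x)
    then obtain a b where ab: "x = lbr L a b" "a \<in> A" "b \<in> A" by blast
    have "lbr L u x = ladd L (lbr L (lbr L u a) b) (lbr L a (lbr L u b))"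
      unfolding ab(1) by (rule leibniz) (use ab u AL in auto)
    moreover have "lbr L (lbr L u a) b \<in> brsp L A A" "lbr L a (lbr L u b) \<in> brsp L A A"
      using ab u Abr by (auto intro: br_mem_brsp)
    ultimately show ?case by (simp add: brsp_def lspan.add)
  next
    case (add x y)
    then have "x \<in> lcar L" "y \<in> lcar L" using brsp_subset[OF AL AL] by (auto simp: brsp_def)
    then show ?case using add u by (auto simp: br_add intro: lspan.add)
  next
    case (scale x a)
    then have "x \<in> lcar L" using brsp_subset[OF AL AL] by (auto simp: brsp_def)
    then show ?case using scale u by (auto simp: br_scale intro: lspan.scale)
  qed
  moreover have "\<And>u v a. u \<in> brsp L A A \<Longrightarrow> v \<in> brsp L A A \<Longrightarrow> ladd L u v \<in> brsp L A A"
    "\<And>u a. u \<in> brsp L A A \<Longrightarrow> lscale L a u \<in> brsp L A A" "lzero L \<in> brsp L A A"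
    by (auto simp: brsp_def intro: lspan.intros)
  ultimately show ?thesis using brsp_subset[OF AL AL] unfolding lie_ideal_def by blast
qed

text \<open>Right-normed brackets are the only ones for which nilpotency will be needed, since the
  vectors e_ij have that shape. With v counted, the bracket has one entry more than
  \<open>us\<close>.\<close>

lemma nested_br_lcs:
  assumes "set us \<subseteq> lcar L" "v \<in> lcar L"
  shows "foldr (lbr L) us v \<in> lcs L (Suc (length us))"
  using assms by (induction us) (auto simp: br_mem_brsp)

end

lemma lie_epi_nested_br:
  assumes "lie_alg L" "lie_epi L M \<pi>" "set us \<subseteq> lcar L" "v \<in> lcar L"
  shows "foldr (lbr L) us v \<in> lcar L \<and> foldr (lbr M) (map \<pi> us) (\<pi> v) = \<pi> (foldr (lbr L) us v)"
proof -
  interpret lie_alg L by fact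
  show ?thesis
    using assms(2-) by (induction us) (auto simp: lie_epi_def closed)
qed

section \<open>Counting linearly independent lists by coordinates\<close>

text \<open>Carriers of \<open>lie\<close> records are sets with their own operations. Functions
  \<open>'i \<Rightarrow> 'k\<close> form a genuine vector space, and linear independence is
  transported there.\<close>

definition fscale :: "'k::field \<Rightarrow> ('i \<Rightarrow> 'k) \<Rightarrow> 'i \<Rightarrow> 'k" where
  "fscale a f = (\<lambda>x. a * f x)"

interpretation fs: vector_space "fscale :: 'k::field \<Rightarrow> ('i \<Rightarrow> 'k) \<Rightarrow> _"
  by unfold_locales (auto simp: fscale_def algebra_simps)

definition coord_space :: "'i set \<Rightarrow> ('i \<Rightarrow> 'k::field) set" where
  "coord_space J = {v. \<forall>p. p \<notin> J \<longrightarrow> v p = 0}"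

definition unit_fun :: "'i \<Rightarrow> 'i \<Rightarrow> 'k::field" where
  "unit_fun p = (\<lambda>q. if q = p then 1 else 0)"

lemma sum_fun_apply: "(\<Sum>i\<in>A. f i) x = (\<Sum>i\<in>A. f i x)"
  by (induction A rule: infinite_finite_induct) auto

lemma unit_fun_inject: "unit_fun p = (unit_fun q :: 'i \<Rightarrow> 'k::field) \<longleftrightarrow> p = q"
  by (auto simp: unit_fun_def fun_eq_iff split: if_splits)

lemma card_unit_fun: "card (unit_fun ` J :: ('i \<Rightarrow> 'k::field) set) = card J"
  by (rule card_image) (simp add: inj_on_def unit_fun_inject)

lemma coord_space_expand:
  assumes "finite J" "v \<in> coord_space J"
  shows "v = (\<Sum>p\<in>J. fscale (v p) (unit_fun p))"
proof
  fix q
  have "(\<Sum>p\<in>J. v p * (if q = p then 1 else 0)) = (\<Sum>p\<in>J. if q = p then v p else 0)"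
    by (rule sum.cong) auto
  then show "v q = (\<Sum>p\<in>J. fscale (v p) (unit_fun p)) q"
    using assms by (auto simp: sum_fun_apply fscale_def unit_fun_def coord_space_def)
qed

lemma coord_space_span:
  fixes J :: "'i set"
  assumes "finite J"
  shows "(coord_space J :: ('i \<Rightarrow> 'k::field) set) \<subseteq> fs.span (unit_fun ` J)"
proof
  fix v :: "'i \<Rightarrow> 'k" assume "v \<in> coord_space J"
  from coord_space_expand[OF assms this] show "v \<in> fs.span (unit_fun ` J)"
    by (metis (no_types, lifting) fs.span_sum fs.span_scale fs.span_base imageI)
qed

lemma independent_unit_fun:
  assumes "finite J"
  shows "\<not> fs.dependent (unit_fun ` J :: ('i \<Rightarrow> 'k::field) set)"
proof
  assume "fs.dependent (unit_fun ` J :: ('i \<Rightarrow> 'k::field) set)"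
  then obtain u q where q: "q \<in> J" "u (unit_fun q :: 'i \<Rightarrow> 'k) \<noteq> 0"
    and s: "(\<Sum>v\<in>unit_fun ` J. fscale (u v) v) = (0 :: 'i \<Rightarrow> 'k)"
    using assms by (auto simp: fs.dependent_finite)
  have "(\<Sum>v\<in>unit_fun ` J. fscale (u v) v) = (\<Sum>p\<in>J. fscale (u (unit_fun p :: 'i \<Rightarrow> 'k)) (unit_fun p))"
    by (subst sum.reindex) (auto simp: inj_on_def unit_fun_inject)
  then have "(\<Sum>p\<in>J. fscale (u (unit_fun p)) (unit_fun p)) q = (0::'k)"
    using s by simp
  also have "(\<Sum>p\<in>J. fscale (u (unit_fun p)) (unit_fun p)) q
      = (\<Sum>p\<in>J. if q = p then u (unit_fun p) else 0)"
    by (auto simp: sum_fun_apply fscale_def unit_fun_def intro: sum.cong)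
  finally show False using q assms by auto
qed

lemma unit_fun_coord_space: "p \<in> J \<Longrightarrow> unit_fun p \<in> coord_space J"
  by (auto simp: unit_fun_def coord_space_def)

text \<open>A linear form costs at most one dimension: some vector w complements its kernel.
  Linearity is asked only on W, because the forms used later go through a choice of preimages that
  is controlled only on a subspace.\<close>

lemma span_kernel:
  fixes h :: "('i \<Rightarrow> 'k::field) \<Rightarrow> 'k"
  assumes "fs.subspace W"
    and "\<And>u v. u \<in> W \<Longrightarrow> v \<in> W \<Longrightarrow> h (u + v) = h u + h v"
    and "\<And>a u. u \<in> W \<Longrightarrow> h (fscale a u) = a * h u"
  obtains w where "W \<subseteq> fs.span (insert w {v\<in>W. h v = 0})" "fs.subspace {v\<in>W. h v = 0}"
proof -
  have h0: "h 0 = 0"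
    using assms(3)[of 0 0] fs.subspace_0[OF assms(1)] by simp
  have sub: "fs.subspace {v\<in>W. h v = 0}"
    using assms h0 by (auto simp: fs.subspace_def)
  show ?thesis
  proof (cases "\<exists>w\<in>W. h w \<noteq> 0")
    case False
    then have "W = {v\<in>W. h v = 0}" by auto
    then show ?thesis using that[of 0] sub fs.span_superset by (metis subset_insertI subset_trans)
  next
    case True
    then obtain w where w: "w \<in> W" "h w \<noteq> 0" by blast
    have "W \<subseteq> fs.span (insert w {v\<in>W. h v = 0})"
    proof
      fix v assume v: "v \<in> W"
      \<comment> \<open>Subtracting this multiple of w moves v into the kernel.\<close>
      let ?a = "h v / h w"
      let ?r = "v + fscale (- ?a) w"
      have aw: "fscale (- ?a) w \<in> W" using w assms(1) fs.subspace_scale by blast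
      have "?r \<in> W" using v aw assms(1) fs.subspace_add by blast
      moreover have "h ?r = 0" using assms(2)[OF v aw] assms(3)[OF w(1), of "- ?a"] w(2) by simp
      ultimately have "?r \<in> fs.span (insert w {v\<in>W. h v = 0})"
        by (intro fs.span_base) auto
      moreover have "fscale ?a w \<in> fs.span (insert w {v\<in>W. h v = 0})"
        by (intro fs.span_scale fs.span_base) auto
      moreover have "v = ?r + fscale ?a w" by (auto simp: fscale_def)
      ultimately show "v \<in> fs.span (insert w {v\<in>W. h v = 0})"
        using fs.span_add[of ?r _ "fscale ?a w"] by simp
    qed
    then show ?thesis using sub by (rule that)
  qed
qed

text \<open>A basis B of the common kernel spans, together with one vector for each form, the whole
  coordinate space, which contains \<open>card J\<close> independent unit vectors.\<close>

lemma independent_in_kernels: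
  fixes h1 h2 :: "('i \<Rightarrow> 'k::field) \<Rightarrow> 'k"
  assumes fin: "finite J"
    and h1: "\<And>u v. u \<in> coord_space J \<Longrightarrow> v \<in> coord_space J \<Longrightarrow> h1 (u + v) = h1 u + h1 v"
    "\<And>a u. u \<in> coord_space J \<Longrightarrow> h1 (fscale a u) = a * h1 u"
    and h2: "\<And>u v. u \<in> coord_space J \<Longrightarrow> v \<in> coord_space J \<Longrightarrow> h2 (u + v) = h2 u + h2 v"
    "\<And>a u. u \<in> coord_space J \<Longrightarrow> h2 (fscale a u) = a * h2 u"
  obtains B where "finite B" "\<not> fs.dependent B" "B \<subseteq> {v\<in>coord_space J. h1 v = 0 \<and> h2 v = 0}"
    "card J \<le> card B + 2"
proof -
  have W: "fs.subspace (coord_space J :: ('i \<Rightarrow> 'k) set)"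
    by (auto simp: fs.subspace_def coord_space_def fscale_def)
  obtain w1 where w1: "coord_space J \<subseteq> fs.span (insert w1 {v\<in>coord_space J. h1 v = 0})"
    and s1: "fs.subspace {v\<in>coord_space J. h1 v = 0}"
    using span_kernel[OF W h1] by blast
  let ?W = "{v\<in>{v\<in>coord_space J. h1 v = 0}. h2 v = 0}"
  obtain w2 where w2: "{v\<in>coord_space J. h1 v = 0} \<subseteq> fs.span (insert w2 ?W)"
    by (rule span_kernel[OF s1, of h2]) (use h2 in auto)
  obtain B where B: "B \<subseteq> ?W" "\<not> fs.dependent B" "?W \<subseteq> fs.span B"
    using fs.maximal_independent_subset by blast
  have "finite B"
  proof -
    have "B \<subseteq> fs.span (unit_fun ` J)" using B(1) coord_space_span[OF fin] by blast
    then show ?thesis using fs.independent_span_bound[OF _ B(2)] fin by blast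
  qed
  have "coord_space J \<subseteq> fs.span (insert w1 (insert w2 B))"
  proof -
    have "insert w2 ?W \<subseteq> fs.span (insert w2 B)"
      using B(3) fs.span_mono[of B "insert w2 B"] fs.span_base[of w2 "insert w2 B"] by blast
    then have "{v\<in>coord_space J. h1 v = 0} \<subseteq> fs.span (insert w2 B)"
      using subset_trans[OF w2 fs.span_minimal[OF _ fs.subspace_span]] by blast
    then have "insert w1 {v\<in>coord_space J. h1 v = 0} \<subseteq> fs.span (insert w1 (insert w2 B))"
      using fs.span_mono[of "insert w2 B" "insert w1 (insert w2 B)"]
        fs.span_base[of w1 "insert w1 (insert w2 B)"] by blast
    then show ?thesis
      using subset_trans[OF w1 fs.span_minimal[OF _ fs.subspace_span]] by blast
  qed
  then have sub: "unit_fun ` J \<subseteq> fs.span (insert w1 (insert w2 B))"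
    by (rule subset_trans[rotated]) (auto intro: unit_fun_coord_space)
  have "card (unit_fun ` J :: ('i \<Rightarrow> 'k) set) \<le> card (insert w1 (insert w2 B))"
    using fs.independent_span_bound[OF _ independent_unit_fun[OF fin] sub] \<open>finite B\<close> by simp
  also have "\<dots> \<le> card B + 2"
    using \<open>finite B\<close>
    by (simp add: card_insert_if)
  finally show ?thesis
    using that \<open>finite B\<close> B by (auto simp: card_unit_fun)
qed

section \<open>Bounds for \<open>ldim\<close> by linear maps into function spaces\<close>

lemma ldim_le:
  assumes "\<And>vs. lin_indep L vs \<Longrightarrow> set vs \<subseteq> S \<Longrightarrow> length vs \<le> m"
  shows "ldim L S \<le> m"
proof -
  let ?P = "\<lambda>n. \<exists>vs. length vs = n \<and> set vs \<subseteq> S \<and> lin_indep L vs"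
  have "?P 0" by (simp add: lin_indep_def)
  then have "?P (ldim L S)"
    unfolding ldim_def by (rule GreatestI_nat[where b = m]) (use assms in metis)
  then show ?thesis using assms by metis
qed

text \<open>\<open>GREATEST\<close> has a usable value only for a bounded predicate, so even a lower
  bound for the dimension needs some a priori upper bound m, however crude.\<close>

lemma ldim_ge:
  assumes "\<And>vs. lin_indep L vs \<Longrightarrow> set vs \<subseteq> S \<Longrightarrow> length vs \<le> m"
    and "lin_indep L vs" "set vs \<subseteq> S"
  shows "length vs \<le> ldim L S"
  unfolding ldim_def by (rule Greatest_le_nat[where b = m]) (use assms in metis)+

definition lin_map_on :: "('k::field, 'e) lie \<Rightarrow> 'e set \<Rightarrow> ('e \<Rightarrow> 'i \<Rightarrow> 'k) \<Rightarrow> bool" where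
  "lin_map_on L S \<Psi> \<longleftrightarrow> (\<forall>u\<in>S. \<forall>v\<in>S. ladd L u v \<in> S \<and> \<Psi> (ladd L u v) = \<Psi> u + \<Psi> v) \<and>
     (\<forall>a. \<forall>u\<in>S. lscale L a u \<in> S \<and> \<Psi> (lscale L a u) = fscale a (\<Psi> u)) \<and>
     lzero L \<in> S \<and> \<Psi> (lzero L) = 0"

lemma lin_map_on_lcomb:
  assumes "lin_map_on L S \<Psi>" "set vs \<subseteq> S"
  shows "lcomb L cs vs \<in> S \<and> \<Psi> (lcomb L cs vs) = (\<Sum>(a, v)\<leftarrow>zip cs vs. fscale a (\<Psi> v))"
  using assms(2)
proof (induction cs vs rule: list_induct2')
  case (4 a cs v vs)
  then show ?case using assms(1) by (simp add: lcomb_def lin_map_on_def)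
qed (use assms(1) in \<open>simp_all add: lcomb_def lin_map_on_def\<close>)

text \<open>A linear map with trivial kernel on S sends an independent list to independent vectors
  of the span of T, and there the exchange argument bounds their number.\<close>

lemma lin_indep_length_le:
  assumes lin: "lin_map_on L S \<Psi>" and ker: "\<And>u. u \<in> S \<Longrightarrow> \<Psi> u = 0 \<Longrightarrow> u = lzero L"
    and T: "\<Psi> ` S \<subseteq> fs.span T" "finite T"
    and vs: "lin_indep L vs" "set vs \<subseteq> S"
  shows "length vs \<le> card T"
proof -
  have dist: "distinct vs" using vs by (simp add: lin_indep_def)
  have zip_map: "zip (map c vs) vs = map (\<lambda>v. (c v, v)) vs" for c :: "'b \<Rightarrow> 'a"
    by (induction vs) auto
  have sum: "\<Psi> (lcomb L (map c vs) vs) = (\<Sum>v\<in>set vs. fscale (c v) (\<Psi> v))" for c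
    using lin_map_on_lcomb[OF lin vs(2), of "map c vs"] dist
    by (simp add: zip_map sum_list_distinct_conv_sum_set comp_def)
  have zero: "c v = 0" if "(\<Sum>v\<in>set vs. fscale (c v) (\<Psi> v)) = 0" "v \<in> set vs" for c v
  proof -
    have "lcomb L (map c vs) vs = lzero L"
      using ker lin_map_on_lcomb[OF lin vs(2)] sum[of c] that(1) by metis
    then have "\<forall>a\<in>set (map c vs). a = 0"
      using vs(1) unfolding lin_indep_def by (metis length_map)
    then show ?thesis using that(2) by auto
  qed
  have inj: "inj_on \<Psi> (set vs)"
  proof (rule inj_onI, rule ccontr)
    fix x y assume xy: "x \<in> set vs" "y \<in> set vs" "\<Psi> x = \<Psi> y" "x \<noteq> y"
    \<comment> \<open>Two list entries with the same image would satisfy the relation with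
      coefficients 1 and -1.\<close>
    let ?c = "\<lambda>v. if v = x then 1 else if v = y then - 1 else (0::'a)"
    have "(\<Sum>v\<in>set vs. fscale (?c v) (\<Psi> v)) = (\<Sum>v\<in>{x, y}. fscale (?c v) (\<Psi> v))"
      using xy by (intro sum.mono_neutral_right) (auto simp: fscale_def)
    also have "\<dots> = 0" using xy by (auto simp: fscale_def)
    finally show False using zero[of ?c x] xy by simp
  qed
  have "\<not> fs.dependent (\<Psi> ` set vs)"
  proof
    assume "fs.dependent (\<Psi> ` set vs)"
    then obtain u w where "w \<in> set vs" "u (\<Psi> w) \<noteq> 0" "(\<Sum>v\<in>\<Psi> ` set vs. fscale (u v) v) = 0"
      by (auto simp: fs.dependent_finite)
    then show False using zero[of "\<lambda>v. u (\<Psi> v)" w] inj by (simp add: sum.reindex)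
  qed
  moreover have "\<Psi> ` set vs \<subseteq> fs.span T" using T vs by blast
  ultimately have "card (\<Psi> ` set vs) \<le> card T"
    using fs.independent_span_bound[OF T(2)] by blast
  then show ?thesis using inj dist by (simp add: card_image distinct_card)
qed

text \<open>Arbitrary preimages of independent vectors are independent: a relation between them maps
  to a relation between the vectors of B.\<close>

lemma lin_indep_exists:
  assumes lin: "lin_map_on L (lcar L) \<Psi>" and S: "S \<subseteq> lcar L"
    and B: "finite B" "\<not> fs.dependent B" "B \<subseteq> \<Psi> ` S"
  obtains vs where "lin_indep L vs" "set vs \<subseteq> S" "length vs = card B"
proof -
  obtain bs where bs: "set bs = B" "distinct bs" using B(1) finite_distinct_list by blast
  define g where "g b = (SOME u. u \<in> S \<and> \<Psi> u = b)" for b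
  have g: "g b \<in> S" "\<Psi> (g b) = b" if "b \<in> B" for b
    using someI_ex[of "\<lambda>u. u \<in> S \<and> \<Psi> u = b"] that B(3) unfolding g_def by auto
  have sub: "set (map g bs) \<subseteq> lcar L" using bs g S by auto
  have "\<forall>a\<in>set cs. a = 0"
    if cs: "length cs = length (map g bs)" "lcomb L cs (map g bs) = lzero L" for cs
  proof -
    have len: "length cs = length bs" using cs by simp
    define u where "u b = the (map_of (zip bs cs) b)" for b
    have u: "map u bs = cs"
      using len bs(2) by (auto simp: u_def map_of_zip_nth intro!: nth_equalityI)
    have "0 = (\<Sum>(a, v)\<leftarrow>zip (map u bs) (map g bs). fscale a (\<Psi> v))"
      using lin_map_on_lcomb[OF lin sub, of cs] cs(2) lin u by (simp add: lin_map_on_def)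
    also have "\<dots> = (\<Sum>b\<leftarrow>bs. fscale (u b) (\<Psi> (g b)))"
      by (simp add: zip_map_map zip_same_conv_map comp_def)
    also have "\<dots> = (\<Sum>b\<in>B. fscale (u b) b)"
      using bs g by (auto simp: sum_list_distinct_conv_sum_set intro: sum.cong)
    finally have "\<forall>b\<in>B. u b = 0"
      using B(2) unfolding fs.dependent_finite[OF B(1)] by metis
    then show ?thesis using u bs by auto
  qed
  moreover have "distinct (map g bs)"
    using bs g by (metis distinct_map inj_on_inverseI)
  ultimately have "lin_indep L (map g bs)" using sub by (auto simp: lin_indep_def)
  then show ?thesis
    using that[of "map g bs"] bs g by (auto simp: distinct_card image_subset_iff)
qed

section \<open>Abelianised words\<close>

lemma freeLie_Nil: "f \<in> freeLie_set g \<Longrightarrow> f [] = 0"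
  by (induction rule: freeLie_set.induct) (auto simp: gen_def ncbr_def ncmul_def)

text \<open>Both sides run over the ways to cut w into three pieces. On the left i is the position
  of the second cut, on the right it is the length of the middle piece.\<close>

lemma ncmul_triple:
  "(\<Sum>i\<le>length w. (\<Sum>j\<le>i. f (take j w) * g (drop j (take i w))) * h (drop i w))
    = (\<Sum>j\<le>length w. f (take j w) * (\<Sum>i\<le>length w - j. g (take i (drop j w)) * h (drop (i + j) w)))"
  for f g h :: "'k::field ncpoly"
proof -
  let ?n = "length w"
  have "(\<Sum>i\<le>?n. (\<Sum>j\<le>i. f (take j w) * g (drop j (take i w))) * h (drop i w))
      = (\<Sum>(i, j)\<in>(SIGMA i:{..?n}. {..i}). f (take j w) * g (drop j (take i w)) * h (drop i w))"
    by (simp add: sum.Sigma sum_distrib_right)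
  also have "\<dots> = (\<Sum>(j, i)\<in>(SIGMA j:{..?n}. {..?n - j}). f (take j w) * g (take i (drop j w)) * h (drop (i + j) w))"
    by (rule sum.reindex_bij_witness[where i = "\<lambda>(j, i). (i + j, j)" and j = "\<lambda>(i, j). (j, i - j)"])
      (auto simp: take_drop)
  also have "\<dots> = (\<Sum>j\<le>?n. f (take j w) * (\<Sum>i\<le>?n - j. g (take i (drop j w)) * h (drop (i + j) w)))"
    by (simp add: sum.Sigma sum_distrib_left mult.assoc)
  finally show ?thesis .
qed

lemma ncmul_assoc: "ncmul (ncmul f g) h = ncmul f (ncmul g h)"
proof
  fix w
  have "ncmul (ncmul f g) h w
      = (\<Sum>i\<le>length w. (\<Sum>j\<le>i. f (take j w) * g (drop j (take i w))) * h (drop i w))"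
    by (auto simp: ncmul_def min_def intro!: sum.cong)
  also have "\<dots> = ncmul f (ncmul g h) w"
    unfolding ncmul_triple by (simp add: ncmul_def add.commute)
  finally show "ncmul (ncmul f g) h w = ncmul f (ncmul g h) w" .
qed

lemma ncmul_add: "ncmul f (\<lambda>w. g w + h w) = (\<lambda>w. ncmul f g w + ncmul f h w)"
  and add_ncmul: "ncmul (\<lambda>w. f w + g w) h = (\<lambda>w. ncmul f h w + ncmul g h w)"
  and ncmul_diff: "ncmul f (\<lambda>w. g w - h w) = (\<lambda>w. ncmul f g w - ncmul f h w)"
  and diff_ncmul: "ncmul (\<lambda>w. f w - g w) h = (\<lambda>w. ncmul f h w - ncmul g h w)"
  and ncmul_scale: "ncmul f (\<lambda>w. a * g w) = (\<lambda>w. a * ncmul f g w)"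
  and scale_ncmul: "ncmul (\<lambda>w. a * f w) g = (\<lambda>w. a * ncmul f g w)"
  by (auto simp: ncmul_def algebra_simps sum.distrib sum_subtractf sum_distrib_left)

lemma lie_alg_F: "lie_alg (F g)"
  by unfold_locales
    (auto simp: F_def freeLie_set.intros freeLie_set.br[unfolded ncbr_def] algebra_simps ncbr_def ncmul_add add_ncmul
      ncmul_diff diff_ncmul ncmul_scale scale_ncmul ncmul_assoc)

definition words :: "nat \<Rightarrow> nat \<Rightarrow> nat list set" where
  "words a b = {w. set w \<subseteq> {0, 1} \<and> count_list w 0 = a \<and> count_list w 1 = b}"

lemma length_words: "w \<in> words a b \<Longrightarrow> length w = a + b"
proof -
  have "set w \<subseteq> {0, 1} \<Longrightarrow> length w = count_list w 0 + count_list w 1"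
    by (induction w) auto
  then show "w \<in> words a b \<Longrightarrow> length w = a + b" by (auto simp: words_def)
qed

lemma finite_words: "finite (words a b)"
proof (rule finite_subset)
  show "words a b \<subseteq> {w. set w \<subseteq> {0, 1} \<and> length w = a + b}"
    using length_words by (auto simp: words_def)
qed (simp add: finite_lists_length_eq)

lemma append_words:
  "u @ v \<in> words a b \<longleftrightarrow> (\<exists>i\<le>a. \<exists>j\<le>b. u \<in> words i j \<and> v \<in> words (a - i) (b - j))"
  by (auto simp: words_def)

lemma words_0_0: "words 0 0 = {[]}"
  using length_words by (fastforce simp: words_def)

text \<open>The coefficient of X^a Y^b after the letters 0 and 1 are made to commute and all other
  letters are sent to 0.\<close>

definition wsum :: "'k::field ncpoly \<Rightarrow> nat \<Rightarrow> nat \<Rightarrow> 'k" where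
  "wsum f a b = (\<Sum>w\<in>words a b. f w)"

text \<open>Abelianisation is multiplicative: cutting a word of bidegree (a, b) amounts to splitting
  the bidegree and choosing a word for each part.\<close>

lemma wsum_ncmul:
  "wsum (ncmul f h) a b = (\<Sum>i\<le>a. \<Sum>j\<le>b. wsum f i j * wsum h (a - i) (b - j))"
proof -
  have "wsum (ncmul f h) a b
      = (\<Sum>(w, k)\<in>(SIGMA w:words a b. {..length w}). f (take k w) * h (drop k w))"
    by (simp add: wsum_def ncmul_def sum.Sigma finite_words)
  also have "\<dots> = (\<Sum>((i, j), (u, v))\<in>(SIGMA x:{..a} \<times> {..b}.
      words (fst x) (snd x) \<times> words (a - fst x) (b - snd x)). f u * h v)"
  proof (rule sum.reindex_bij_witness[where
      j = "\<lambda>(w, k). ((count_list (take k w) 0, count_list (take k w) 1), (take k w, drop k w))"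
      and i = "\<lambda>((i, j), (u, v)). (u @ v, length u)"], goal_cases)
    case (2 x)
    obtain w k where x: "x = (w, k)" by force
    have w: "w \<in> words a b" using 2 x by simp
    then have "take k w @ drop k w \<in> words a b" by simp
    then obtain i j where "i \<le> a" "j \<le> b" "take k w \<in> words i j" "drop k w \<in> words (a - i) (b - j)"
      unfolding append_words by blast
    then show ?case using x by (auto simp: words_def)
  next
    case (4 x)
    obtain i j u v where x: "x = ((i, j), (u, v))" by (metis surj_pair)
    then have "u @ v \<in> words a b" using 4 append_words by fastforce
    then show ?case using x by simp
  qed (auto simp: words_def)
  also have "\<dots> = (\<Sum>x\<in>{..a} \<times> {..b}. \<Sum>y\<in>words (fst x) (snd x) \<times> words (a - fst x) (b - snd x).
      f (fst y) * h (snd y))"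
    by (subst sum.Sigma) (auto simp: finite_words case_prod_beta)
  also have "\<dots> = (\<Sum>i\<le>a. \<Sum>j\<le>b. wsum f i j * wsum h (a - i) (b - j))"
    by (simp add: wsum_def sum_product sum.cartesian_product case_prod_beta)
  finally show ?thesis .
qed

lemma wsum_commute: "wsum (ncmul f h) a b = wsum (ncmul h f) a b"
proof -
  have "wsum (ncmul f h) a b = (\<Sum>(i, j)\<in>{..a} \<times> {..b}. wsum f i j * wsum h (a - i) (b - j))"
    by (simp add: wsum_ncmul sum.cartesian_product)
  also have "\<dots> = (\<Sum>(i, j)\<in>{..a} \<times> {..b}. wsum h i j * wsum f (a - i) (b - j))"
    by (rule sum.reindex_bij_witness[where i = "\<lambda>(i, j). (a - i, b - j)" and j = "\<lambda>(i, j). (a - i, b - j)"])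
      (auto simp: mult.commute)
  also have "\<dots> = wsum (ncmul h f) a b"
    by (simp add: wsum_ncmul sum.cartesian_product)
  finally show ?thesis .
qed

lemma words_singleton: "[x] \<in> words a b \<longleftrightarrow> (x = 0 \<and> a = 1 \<and> b = 0 \<or> x = 1 \<and> a = 0 \<and> b = 1)"
  by (auto simp: words_def)

lemma words_1: "words 1 0 = {[0]}" "words 0 1 = {[1]}"
proof -
  have "w \<in> words 1 0 \<Longrightarrow> w = [0]" for w
    using length_words[of w 1 0] by (auto simp: length_Suc_conv words_def)
  then show "words 1 0 = {[0]}" by (auto simp: words_def)
  have "w \<in> words 0 1 \<Longrightarrow> w = [1]" for w
    using length_words[of w 0 1] by (auto simp: length_Suc_conv words_def)
  then show "words 0 1 = {[1]}" by (auto simp: words_def)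
qed

text \<open>The image of a Lie element in the commutative polynomial ring is a linear form,
  because brackets vanish there.\<close>

lemma wsum_freeLie:
  assumes "f \<in> freeLie_set g" "(a, b) \<noteq> (1, 0)" "(a, b) \<noteq> (0, 1)"
  shows "wsum f a b = 0"
  using assms(1)
proof induction
  case (gen i)
  have "w \<noteq> [i]" if "w \<in> words a b" for w
    using that assms words_singleton by auto
  then show ?case by (simp add: wsum_def gen_def)
next
  case (add f h)
  then show ?case by (simp add: wsum_def sum.distrib)
next
  case (scale f c)
  then show ?case by (simp add: wsum_def flip: sum_distrib_left)
next
  case (br f h)
  have "wsum (ncbr f h) a b = wsum (ncmul f h) a b - wsum (ncmul h f) a b"
    by (simp add: wsum_def ncbr_def sum_subtractf)
  then show ?case by (simp add: wsum_commute)
qed (simp add: wsum_def)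

text \<open>The abelianised Fox derivative with respect to the letter 1.\<close>

definition dsum :: "'k::field ncpoly \<Rightarrow> nat \<Rightarrow> nat \<Rightarrow> 'k" where
  "dsum f = wsum (\<lambda>w. f (w @ [1]))"

text \<open>Fox's product rule has a second term, the derivative of f times the constant term of h,
  and Lie elements have no constant term. In the remaining term the abelianisation of f is the
  linear form f[0] X + f[1] Y, which leaves two shifts of the derivative of h.\<close>

lemma dsum_ncmul:
  assumes f: "f \<in> freeLie_set g" and h: "h \<in> freeLie_set g"
  shows "dsum (ncmul f h) a b = (if a = 0 then 0 else f [0] * dsum h (a - 1) b)
      + (if b = 0 then 0 else f [1] * dsum h a (b - 1))"
proof -
  let ?h = "\<lambda>w. h (w @ [1])"
  have "ncmul f h (w @ [1]) = ncmul f ?h w" for w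
    using freeLie_Nil[OF h] by (simp add: ncmul_def)
  then have "dsum (ncmul f h) a b = wsum (ncmul f ?h) a b"
    by (simp add: dsum_def)
  also have "\<dots> = (\<Sum>(i, j)\<in>{..a} \<times> {..b}. wsum f i j * dsum h (a - i) (b - j))"
    by (simp add: wsum_ncmul dsum_def sum.cartesian_product)
  also have "\<dots> = (\<Sum>(i, j)\<in>({..a} \<times> {..b}) \<inter> {(1, 0), (0, 1)}. wsum f i j * dsum h (a - i) (b - j))"
  proof (rule sum.mono_neutral_right)
    show "\<forall>x\<in>{..a} \<times> {..b} - ({..a} \<times> {..b}) \<inter> {(1, 0), (0, 1)}.
        (case x of (i, j) \<Rightarrow> wsum f i j * dsum h (a - i) (b - j)) = 0"
    proof
      fix x assume x: "x \<in> {..a} \<times> {..b} - ({..a} \<times> {..b}) \<inter> {(1, 0), (0, 1)}"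
      obtain i j where ij: "x = (i, j)" by force
      then have "wsum f i j = 0" using x by (intro wsum_freeLie[OF f]) auto
      then show "(case x of (i, j) \<Rightarrow> wsum f i j * dsum h (a - i) (b - j)) = 0" using ij by simp
    qed
  qed auto
  also have "\<dots> = (if a = 0 then 0 else f [0] * dsum h (a - 1) b)
      + (if b = 0 then 0 else f [1] * dsum h a (b - 1))"
  proof -
    have "wsum f (Suc 0) 0 = f [0]" "wsum f 0 (Suc 0) = f [Suc 0]"
      using words_1 by (simp_all add: wsum_def)
    moreover have "({..a} \<times> {..b}) \<inter> {(1, 0), (0, 1)}
        = (if a = 0 then {} else {(1, 0)}) \<union> (if b = 0 then {} else {(0, 1)})"
      by auto
    ultimately show ?thesis by simp
  qed
  finally show ?thesis .
qed

lemma dsum_ncbr: "dsum (ncbr f h) a b = dsum (ncmul f h) a b - dsum (ncmul h f) a b"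
  by (simp add: dsum_def wsum_def ncbr_def sum_subtractf)

lemma dsum_0_0: "dsum f 0 0 = f [1]"
  by (simp add: dsum_def wsum_def words_0_0)

text \<open>Setting X = 0 leaves a Lie element in one letter, hence a multiple of Y. In the bracket
  case the two terms cancel for b = 0 by \<open>dsum_0_0\<close> and vanish for larger b by
  induction. This is why no slots (0, j) with j >= 2 are needed.\<close>

lemma dsum_0_Suc:
  assumes "f \<in> freeLie_set g"
  shows "dsum f 0 (Suc b) = 0"
  using assms
proof (induction arbitrary: b)
  case (gen i)
  have "w \<noteq> []" if "w \<in> words 0 (Suc b)" for w
    using length_words[OF that] by auto
  then show ?case by (simp add: dsum_def wsum_def gen_def)
next
  case (add f h)
  then show ?case by (simp add: dsum_def wsum_def sum.distrib)
next
  case (scale f c)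
  then show ?case by (simp add: dsum_def wsum_def flip: sum_distrib_left)
next
  case (br f h)
  then show ?case
    by (cases b) (simp_all add: dsum_ncbr dsum_ncmul[of _ g] dsum_0_0)
qed (simp add: dsum_def wsum_def)

section \<open>Coordinates on the free metabelian nilpotent Lie algebra\<close>

text \<open>Slots (1, 0) and (0, 1) belong to x and y, the others to the e_ij. Pure powers of higher
  degree have no slot, since no commutator has such a bidegree.\<close>

definition bidegrees :: "nat \<Rightarrow> (nat \<times> nat) set" where
  "bidegrees c = {(1, 0), (0, 1)} \<union> {(i, j). 1 \<le> i \<and> 1 \<le> j \<and> i + j \<le> c}"

lemma finite_bidegrees: "finite (bidegrees c)"
  by (rule finite_subset[of _ "{..c + 1} \<times> {..c + 1}"]) (auto simp: bidegrees_def)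

lemma card_bidegrees:
  assumes "c \<ge> 1"
  shows "card (bidegrees c) = 2 + c * (c - 1) div 2"
proof -
  let ?T = "\<lambda>c. {(i, j). 1 \<le> i \<and> 1 \<le> j \<and> i + j \<le> (c::nat)}"
  have fin: "finite (?T c)" for c
    by (rule finite_subset[OF _ finite_bidegrees[of c]]) (auto simp: bidegrees_def)
  \<comment> \<open>Doubling keeps division out of the induction; each step adds the m + 1 points of
    the antidiagonal i + j = m + 2.\<close>
  have "2 * card (?T (Suc m)) = Suc m * m" for m
  proof (induction m)
    case 0
    have "?T (Suc 0) = {}" by auto
    then show ?case by (simp only: card.empty)
  next
    case (Suc m)
    have "?T (Suc (Suc m)) = ?T (Suc m) \<union> (\<lambda>i. (i, Suc (Suc m) - i)) ` {1..Suc m}"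
      by (auto simp: image_iff)
    moreover have "?T (Suc m) \<inter> (\<lambda>i. (i, Suc (Suc m) - i)) ` {1..Suc m} = {}"
      by auto
    moreover have "card ((\<lambda>i. (i, Suc (Suc m) - i)) ` {1..Suc m}) = Suc m"
      by (subst card_image) (auto simp: inj_on_def)
    ultimately have "card (?T (Suc (Suc m))) = card (?T (Suc m)) + Suc m"
      using card_Un_disjoint[OF fin, of "(\<lambda>i. (i, Suc (Suc m) - i)) ` {1..Suc m}" "Suc m"] by simp
    then show ?case using Suc by simp
  qed
  from this[of "c - 1"] have "card (?T c) = c * (c - 1) div 2" using assms by simp
  moreover have "card (bidegrees c) = card {(1::nat, 0::nat), (0, 1)} + card (?T c)"
    unfolding bidegrees_def by (rule card_Un_disjoint) (use fin[of c] in auto)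
  ultimately show ?thesis by simp
qed

text \<open>Coordinates are indexed by bidegree. The case j = 1 is excluded in \<open>half_br\<close> because the slot
  (i, 0) is not part of the commutator ideal: for i = 1 it holds the coefficient of x.\<close>

definition half_br :: "(nat \<times> nat \<Rightarrow> 'k::field) \<Rightarrow> (nat \<times> nat \<Rightarrow> 'k) \<Rightarrow> nat \<times> nat \<Rightarrow> 'k" where
  "half_br u v = (\<lambda>(i, j). if i = 0 \<or> j = 0 then 0
     else u (1, 0) * v (i - 1, j) + (if j = 1 then 0 else u (0, 1) * v (i, j - 1)))"

text \<open>\<open>half_br\<close> is the derivative of a product, the linear part of one factor
  times the derivative of the other; the bracket is its antisymmetrisation, with degrees above c
  discarded.\<close>

definition coord_br :: "nat \<Rightarrow> (nat \<times> nat \<Rightarrow> 'k::field) \<Rightarrow> (nat \<times> nat \<Rightarrow> 'k) \<Rightarrow> nat \<times> nat \<Rightarrow> 'k" where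
  "coord_br c u v = (\<lambda>p. if p \<in> bidegrees c then half_br u v p - half_br v u p else 0)"

text \<open>The derivative strips a final letter 1, so bidegree (i, j) is read at X^i Y^(j-1). It
  kills the generator x, whose coefficient is therefore taken from the word
  \<open>[0]\<close>.\<close>

definition coords :: "nat \<Rightarrow> 'k::field ncpoly \<Rightarrow> nat \<times> nat \<Rightarrow> 'k" where
  "coords c f = (\<lambda>(i, j). if (i, j) \<notin> bidegrees c then 0
     else if j = 0 then f [0] else dsum f i (j - 1))"

lemma coords_add: "coords c (\<lambda>w. f w + h w) = coords c f + coords c h"
  by (auto simp: coords_def dsum_def wsum_def sum.distrib)

lemma coords_scale: "coords c (\<lambda>w. a * f w) = fscale a (coords c f)"
  by (auto simp: coords_def dsum_def wsum_def fscale_def sum_distrib_left)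

lemma coords_space: "coords c f \<in> coord_space (bidegrees c)"
  by (auto simp: coords_def coord_space_def)

lemma coords_ncbr:
  assumes f: "f \<in> freeLie_set g" and h: "h \<in> freeLie_set g"
  shows "coords c (ncbr f h) = coord_br c (coords c f) (coords c h)"
proof
  have half: "dsum (ncmul f h) i (j - 1) = half_br (coords c f) (coords c h) (i, j)"
    if "(i, j) \<in> bidegrees c" "i > 0" "j > 0"
      and f: "f \<in> freeLie_set g" and h: "h \<in> freeLie_set g" for i j f h
  proof -
    have "dsum h (i - 1) (j - 1) = coords c h (i - 1, j)"
    \<comment> \<open>For i = 1 and j >= 2 the slot (0, j) is outside \<open>bidegrees\<close>, so
      its coordinate is 0 by default; \<open>dsum_0_Suc\<close> shows that the derivative vanishes
      there as well.\<close>
    proof (cases "i = 1 \<and> j \<ge> 2")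
      case True
      then obtain k where "j = Suc (Suc k)" by (metis Suc_le_D numeral_2_eq_2 le_SucE Suc_le_mono)
      then show ?thesis using True h by (simp add: coords_def bidegrees_def dsum_0_Suc)
    next
      case False
      then show ?thesis using that by (auto simp: coords_def bidegrees_def)
    qed
    moreover have "dsum h i (j - 1 - 1) = coords c h (i, j - 1)" if "j \<noteq> 1"
      using \<open>(i, j) \<in> bidegrees c\<close> \<open>i > 0\<close> \<open>j > 0\<close> that by (auto simp: coords_def bidegrees_def)
    moreover have "f [0] = coords c f (1, 0)" "f [1] = coords c f (0, 1)"
      by (simp_all add: coords_def bidegrees_def dsum_0_0)
    ultimately show ?thesis
      using that by (simp add: dsum_ncmul[OF f h] half_br_def)
  qed
  fix p :: "nat \<times> nat"
  obtain i j where p: "p = (i, j)" by force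
  \<comment> \<open>A bracket has no linear part, which settles the slots of x and y.\<close>
  have 0: "ncbr f h [0] = 0" "ncbr f h [1] = 0"
    using freeLie_Nil[OF f] freeLie_Nil[OF h] by (simp_all add: ncbr_def ncmul_def)
  show "coords c (ncbr f h) p = coord_br c (coords c f) (coords c h) p"
  proof (cases "(i, j) \<in> bidegrees c \<and> i > 0 \<and> j > 0")
    case True
    then have "coords c (ncbr f h) p = dsum (ncmul f h) i (j - 1) - dsum (ncmul h f) i (j - 1)"
      by (simp add: p coords_def dsum_ncbr)
    then show ?thesis using True half[OF _ _ _ f h] half[OF _ _ _ h f] p by (simp add: coord_br_def)
  next
    case False
    then consider "p \<notin> bidegrees c" | "p = (1, 0)" | "p = (0, 1)"
      using p by (auto simp: bidegrees_def)
    then show ?thesis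
      using 0 by cases (simp_all add: p coords_def coord_br_def half_br_def dsum_0_0)
  qed
qed

section \<open>Descent of the coordinates to the two quotients\<close>

lemma lcs_F_vanish:
  assumes "f \<in> lcs (F g) (Suc k)" "length w \<le> k"
  shows "f w = 0"
  using assms
proof (induction k arbitrary: f w)
  case 0
  then show ?case using freeLie_Nil by (auto simp: F_def)
next
  case (Suc k)
  have "f \<in> lspan (F g) {lbr (F g) a b | a b. a \<in> lcar (F g) \<and> b \<in> lcs (F g) (Suc k)}"
    using Suc.prems by (simp add: brsp_def)
  then have "\<forall>w. length w \<le> Suc k \<longrightarrow> f w = 0"
  proof induction
    case (base x)
    then obtain a b where x: "x = ncbr a b" and a: "a \<in> freeLie_set g"
      and b: "b \<in> lcs (F g) (Suc k)"
      by (auto simp: F_def)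
    have "a (take i w) * b (drop i w) = 0 \<and> b (take i w) * a (drop i w) = 0"
      if "length w \<le> Suc k" "i \<le> length w" for w i
    proof
      show "a (take i w) * b (drop i w) = 0"
        using Suc.IH[OF b, of "drop i w"] that freeLie_Nil[OF a] by (cases "i = 0") auto
      show "b (take i w) * a (drop i w) = 0"
        using Suc.IH[OF b, of "take i w"] that freeLie_Nil[OF a] by (cases "i = length w") auto
    qed
    then have "ncmul a b w = 0 \<and> ncmul b a w = 0" if "length w \<le> Suc k" for w
      using that unfolding ncmul_def by (intro conjI sum.neutral) auto
    then show ?case by (simp add: x ncbr_def)
  qed (auto simp: F_def)
  then show ?case using Suc.prems by blast
qed

text \<open>The coordinate at (i, j) reads only words of length i + j, at most c, and elements of
  the term with index c + 1 vanish on these.\<close>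

lemma coords_lcs:
  assumes "f \<in> lcs (F g) (Suc c)" "c \<ge> 1"
  shows "coords c f = 0"
proof
  fix p :: "nat \<times> nat"
  obtain i j where p: "p = (i, j)" by force
  have "f (w @ [1]) = 0" if "w \<in> words i (j - 1)" "(i, j) \<in> bidegrees c" "j \<noteq> 0" for w
    using lcs_F_vanish[OF assms(1)] length_words[OF that(1)] that assms(2)
    by (auto simp: bidegrees_def)
  then show "coords c f p = 0 p"
    using lcs_F_vanish[OF assms(1), of "[0]"] assms(2)
    by (auto simp: p coords_def dsum_def wsum_def)
qed

text \<open>Nested cosets are handled here once and for all. What leaves this lemma is a surjection
  from the free Lie algebra, coordinates compatible with it, and the metabelian and nilpotent
  identities.\<close>

lemma Mgc_structure:
  fixes g c :: nat and G :: "('k::field, 'k ncpoly set set) lie"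
  assumes c: "c \<ge> 1" and G_def: "G = Mgc g c"
  obtains \<pi> :: "'k ncpoly \<Rightarrow> 'k ncpoly set set" and \<Phi> where
    "lie_alg G" "lie_epi (F g) G \<pi>" "\<And>f. f \<in> freeLie_set g \<Longrightarrow> \<Phi> (\<pi> f) = coords c f"
    "\<And>u v w z. \<lbrakk>u \<in> lcar G; v \<in> lcar G; w \<in> lcar G; z \<in> lcar G\<rbrakk> \<Longrightarrow>
        lbr G (lbr G u v) (lbr G w z) = lzero G"
    "\<And>us v. \<lbrakk>set us \<subseteq> lcar G; v \<in> lcar G; c \<le> length us\<rbrakk> \<Longrightarrow> foldr (lbr G) us v = lzero G"
proof -
  define FF where "FF = (F g :: ('k, 'k ncpoly) lie)"
  have FFs: "lcar FF = freeLie_set g" "ladd FF = (\<lambda>f h w. f w + h w)"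
    "lscale FF = (\<lambda>a f w. a * f w)" "lbr FF = ncbr"
    by (simp_all add: FF_def F_def)
  interpret F: lie_alg FF unfolding FF_def by (rule lie_alg_F)
  let ?I = "lcs FF (Suc c)"
  interpret FI: lie_alg_ideal FF ?I by unfold_locales (rule F.lie_ideal_lcs)
  define Q where "Q = (Fgc g c :: ('k, 'k ncpoly set) lie)"
  have Q: "Q = quot FF ?I" by (simp add: Q_def Fgc_def FF_def)
  let ?\<pi> = "coset FF ?I"
  have epi1: "lie_epi FF Q ?\<pi>" unfolding Q by (rule FI.quot_epi)
  interpret Q: lie_alg Q by (rule lie_epi_lie_alg[OF F.lie_alg_axioms epi1])
  let ?D = "lcs Q 2"
  have D: "?D = brsp Q (lcar Q) (lcar Q)" by (simp add: numeral_2_eq_2)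
  let ?J = "brsp Q ?D ?D"
  have "lie_ideal Q ?D" using Q.lie_ideal_lcs[of 1] by (simp only: numeral_2_eq_2 One_nat_def)
  then interpret QJ: lie_alg_ideal Q ?J by unfold_locales (rule Q.lie_ideal_brsp)
  have G: "G = quot Q ?J" by (simp add: G_def Mgc_def Q_def)
  let ?\<rho> = "coset Q ?J"
  have epi2: "lie_epi Q G ?\<rho>" unfolding G by (rule QJ.quot_epi)
  interpret G: lie_alg G by (rule lie_epi_lie_alg[OF Q.lie_alg_axioms epi2])
  have epi: "lie_epi FF G (\<lambda>f. ?\<rho> (?\<pi> f))"
    by (rule lie_epi_comp[OF F.lie_alg_axioms epi1 epi2])

  \<comment> \<open>Coordinates of a class are those of its representative; by \<open>kill\<close>
    the choice does not affect them.\<close>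
  let ?\<phi> = "\<lambda>C. coords c (rep C)"
  have kill: "coords c f = 0" if "f \<in> ?I" for f
    using coords_lcs[of f g c] that c by (simp add: FF_def)
  have \<phi>: "?\<phi> (?\<pi> f) = coords c f" if "f \<in> freeLie_set g" for f
    by (rule FI.rep_factor) (use that in \<open>auto simp: FFs coords_add kill\<close>)
  have hom1: "ladd Q (?\<pi> f) (?\<pi> h) = ?\<pi> (\<lambda>w. f w + h w)"
    "lscale Q a (?\<pi> f) = ?\<pi> (\<lambda>w. a * f w)" "lbr Q (?\<pi> f) (?\<pi> h) = ?\<pi> (ncbr f h)"
    if "f \<in> freeLie_set g" "h \<in> freeLie_set g" for a f h
    using epi1 that by (simp_all add: lie_epi_def FFs)
  have Qcar: "lcar Q = ?\<pi> ` freeLie_set g" using epi1 by (simp add: lie_epi_def FFs)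
  have \<phi>_add: "?\<phi> (ladd Q u v) = ?\<phi> u + ?\<phi> v" if "u \<in> lcar Q" "v \<in> lcar Q" for u v
    using that unfolding Qcar by (auto simp: hom1 \<phi> coords_add freeLie_set.intros)
  have \<phi>_scale: "?\<phi> (lscale Q a u) = fscale a (?\<phi> u)" if "u \<in> lcar Q" for u a
    using that unfolding Qcar by (auto simp: hom1 \<phi> coords_scale freeLie_set.intros)
  have \<phi>_br: "?\<phi> (lbr Q u v) = coord_br c (?\<phi> u) (?\<phi> v)" if "u \<in> lcar Q" "v \<in> lcar Q" for u v
    using that unfolding Qcar by (auto simp: hom1 \<phi> coords_ncbr freeLie_set.intros)
  have \<phi>_zero: "?\<phi> (lzero Q) = 0"
    using \<phi>_scale[OF Q.zero_closed, of 0] by (simp add: Q.scale_zero)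
  have \<phi>_D: "?\<phi> u (1, 0) = 0 \<and> ?\<phi> u (0, 1) = 0" if "u \<in> ?D" for u
    using that unfolding D brsp_def
  proof induction
    case (base x)
    then show ?case by (auto simp: \<phi>_br coord_br_def half_br_def)
  next
    case (add x y)
    then have "x \<in> lcar Q" "y \<in> lcar Q"
      using Q.lcs_subset[of 2] unfolding D brsp_def by auto
    then show ?case using add by (simp add: \<phi>_add)
  next
    case (scale x a)
    then have "x \<in> lcar Q"
      using Q.lcs_subset[of 2] unfolding D brsp_def by auto
    then show ?case using scale by (simp add: \<phi>_scale fscale_def)
  qed (simp add: \<phi>_zero)
  \<comment> \<open>Every term of \<open>half_br\<close> contains an x or y coordinate of its first
    argument, and by \<open>\<phi>_D\<close> these are 0 on commutators.\<close>
  have \<phi>_J: "?\<phi> u = 0" if "u \<in> ?J" for u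
    using that unfolding brsp_def[of Q ?D]
  proof induction
    case (base x)
    then obtain a b where x: "x = lbr Q a b" "a \<in> ?D" "b \<in> ?D" by blast
    then have "a \<in> lcar Q" "b \<in> lcar Q" using Q.lcs_subset[of 2] by auto
    then show ?case using \<phi>_D[OF x(2)] \<phi>_D[OF x(3)]
      by (auto simp: x(1) \<phi>_br coord_br_def half_br_def fun_eq_iff)
  next
    case (add x y)
    then have "x \<in> lcar Q" "y \<in> lcar Q"
      using QJ.ideal_simps(1) unfolding brsp_def[of Q ?D] by auto
    then show ?case using add by (simp add: \<phi>_add)
  next
    case (scale x a)
    then have "x \<in> lcar Q"
      using QJ.ideal_simps(1) unfolding brsp_def[of Q ?D] by auto
    then show ?case using scale by (simp add: \<phi>_scale fscale_def fun_eq_iff)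
  qed (simp add: \<phi>_zero)
  have \<Phi>: "?\<phi> (rep (?\<rho> (?\<pi> f))) = coords c f" if "f \<in> freeLie_set g" for f
  proof -
    have "?\<phi> (rep (?\<rho> (?\<pi> f))) = ?\<phi> (?\<pi> f)"
      by (rule QJ.rep_factor[of ?\<phi>]) (use that in \<open>auto simp: \<phi>_add \<phi>_J Qcar\<close>)
    then show ?thesis using \<phi>[OF that] by simp
  qed

  have metab: "lbr G (lbr G u v) (lbr G w z) = lzero G"
    if G4: "u \<in> lcar G" "v \<in> lcar G" "w \<in> lcar G" "z \<in> lcar G" for u v w z
  proof -
    have hom: "lbr G (?\<rho> u) (?\<rho> v) = ?\<rho> (lbr Q u v)" if "u \<in> lcar Q" "v \<in> lcar Q" for u v
      using epi2 that by (simp add: lie_epi_def)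
    have pre: "\<exists>u'. u' \<in> lcar Q \<and> u = ?\<rho> u'" if "u \<in> lcar G" for u
      using that epi2 by (auto simp: lie_epi_def)
    obtain u' v' w' z' where q: "u' \<in> lcar Q" "v' \<in> lcar Q" "w' \<in> lcar Q" "z' \<in> lcar Q"
      "u = ?\<rho> u'" "v = ?\<rho> v'" "w = ?\<rho> w'" "z = ?\<rho> z'"
      using G4[THEN pre] by blast
    have "lbr Q (lbr Q u' v') (lbr Q w' z') \<in> ?J"
      unfolding D by (intro Q.br_mem_brsp q)
    then have "?\<rho> (lbr Q (lbr Q u' v') (lbr Q w' z')) = ?\<rho> (lzero Q)" by (rule QJ.coset_ideal)
    then show ?thesis using q epi2 by (simp add: hom Q.closed lie_epi_def)
  qed
  have nil: "foldr (lbr G) us v = lzero G"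
    if usv: "set us \<subseteq> lcar G" "v \<in> lcar G" "c \<le> length us" for us v
  proof -
    have Gcar: "lcar G = (\<lambda>f. ?\<rho> (?\<pi> f)) ` lcar FF" using epi by (simp add: lie_epi_def)
    have "us \<in> map (\<lambda>f. ?\<rho> (?\<pi> f)) ` lists (lcar FF)"
      using usv(1) unfolding Gcar lists_image[symmetric] by (auto simp: in_lists_conv_set)
    then obtain fs where fs: "set fs \<subseteq> lcar FF" "us = map (\<lambda>f. ?\<rho> (?\<pi> f)) fs"
      by (auto simp: in_lists_conv_set)
    obtain h where h: "h \<in> lcar FF" "v = ?\<rho> (?\<pi> h)" using usv(2) unfolding Gcar by blast
    \<comment> \<open>With at least c outer entries the nested bracket has at least c + 1 entries,
      so it lies in the ideal of the first quotient.\<close>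
    have "antimono (\<lambda>k. lcs FF (Suc k))"
      using F.lcs_Suc_subset by (simp add: antimono_iff_le_Suc)
    then have "lcs FF (Suc (length fs)) \<subseteq> ?I"
      using usv(3) fs(2) by (auto dest!: antimonoD[of _ c "length fs"])
    then have "foldr (lbr FF) fs h \<in> ?I"
      using F.nested_br_lcs[OF fs(1) h(1)] by blast
    then have "?\<pi> (foldr (lbr FF) fs h) = lzero Q"
      using FI.coset_ideal epi1 by (simp add: lie_epi_def)
    moreover have "foldr (lbr G) us v = ?\<rho> (?\<pi> (foldr (lbr FF) fs h))"
      using lie_epi_nested_br[OF F.lie_alg_axioms epi fs(1) h(1)] fs h by simp
    ultimately show ?thesis using epi2 by (simp add: lie_epi_def)
  qed
  show ?thesis
  proof (rule that[of "\<lambda>f. ?\<rho> (?\<pi> f)" "\<lambda>C. ?\<phi> (rep C)"])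
    show "lie_epi (F g) G (\<lambda>f. ?\<rho> (?\<pi> f))" using epi unfolding FF_def .
  qed (fact G.lie_alg_axioms \<Phi> metab nil)+
qed

section \<open>Basis, index and abelian subalgebras\<close>

text \<open>The dimension counts depend on these facts alone. Generation and the two identities will
  bound the algebra from above, the coordinates from below; that \<open>\<Phi>\<close> is bijective
  onto the coordinate space is derived, not assumed.\<close>

locale metabelian_coords = lie_alg L for L :: "('k::field, 'e) lie" +
  fixes c :: nat and x y :: 'e and \<Phi> :: "'e \<Rightarrow> nat \<times> nat \<Rightarrow> 'k"
  assumes x_closed: "x \<in> lcar L" and y_closed: "y \<in> lcar L"
    and generated: "\<And>H. \<lbrakk>x \<in> H; y \<in> H; lzero L \<in> H; \<And>u v. u \<in> H \<Longrightarrow> v \<in> H \<Longrightarrow> ladd L u v \<in> H;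
        \<And>a u. u \<in> H \<Longrightarrow> lscale L a u \<in> H; \<And>u v. u \<in> H \<Longrightarrow> v \<in> H \<Longrightarrow> lbr L u v \<in> H\<rbrakk> \<Longrightarrow> lcar L \<subseteq> H"
    and metabelian: "\<And>u v w z. \<lbrakk>u \<in> lcar L; v \<in> lcar L; w \<in> lcar L; z \<in> lcar L\<rbrakk> \<Longrightarrow>
        lbr L (lbr L u v) (lbr L w z) = lzero L"
    and nilpotent: "\<And>us v. \<lbrakk>set us \<subseteq> lcar L; v \<in> lcar L; c \<le> length us\<rbrakk> \<Longrightarrow> foldr (lbr L) us v = lzero L"
    and \<Phi>_add: "\<And>u v. u \<in> lcar L \<Longrightarrow> v \<in> lcar L \<Longrightarrow> \<Phi> (ladd L u v) = \<Phi> u + \<Phi> v"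
    and \<Phi>_scale: "\<And>a u. u \<in> lcar L \<Longrightarrow> \<Phi> (lscale L a u) = fscale a (\<Phi> u)"
    and \<Phi>_br: "\<And>u v. u \<in> lcar L \<Longrightarrow> v \<in> lcar L \<Longrightarrow> \<Phi> (lbr L u v) = coord_br c (\<Phi> u) (\<Phi> v)"
    and \<Phi>_space: "\<And>u. u \<in> lcar L \<Longrightarrow> \<Phi> u \<in> coord_space (bidegrees c)"
    and \<Phi>_x: "\<Phi> x = unit_fun (1, 0)" and \<Phi>_y: "\<Phi> y = unit_fun (0, 1)"
begin

definition basis :: "nat \<times> nat \<Rightarrow> 'e" where
  "basis = (\<lambda>(i, j). if j = 0 then x else if i = 0 then y
     else (lbr L x ^^ (i - 1)) ((lbr L y ^^ (j - 1)) (lbr L x y)))"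

text \<open>Exponents start at 0 here: \<open>e i j\<close> sits at bidegree (i + 1, j + 1), so the
  e_31 of the overview is \<open>e 2 0\<close>.\<close>

abbreviation e :: "nat \<Rightarrow> nat \<Rightarrow> 'e" where
  "e i j \<equiv> (lbr L x ^^ i) ((lbr L y ^^ j) (lbr L x y))"

lemma e_closed: "e i j \<in> lcar L"
proof -
  have "(lbr L y ^^ j) (lbr L x y) \<in> lcar L"
    by (induction j) (auto simp: closed x_closed y_closed)
  then show ?thesis by (induction i) (auto simp: closed x_closed y_closed)
qed

lemma e_bracket: "\<exists>u\<in>lcar L. \<exists>v\<in>lcar L. e i j = lbr L u v"
proof (cases i)
  case 0
  show ?thesis
  proof (cases j)
    case 0
    then show ?thesis using \<open>i = 0\<close> x_closed y_closed by auto
  next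
    case (Suc k)
    then show ?thesis using \<open>i = 0\<close> y_closed e_closed[of 0 k] by auto
  qed
next
  case (Suc k)
  then show ?thesis using x_closed e_closed[of k j] by auto
qed

lemma basis_closed: "basis p \<in> lcar L"
  by (auto simp: basis_def x_closed y_closed e_closed split: prod.split)

lemma br_e_e: "lbr L (e i j) (e k l) = lzero L"
proof -
  obtain u v w z where "u \<in> lcar L" "v \<in> lcar L" "e i j = lbr L u v"
    "w \<in> lcar L" "z \<in> lcar L" "e k l = lbr L w z"
    using e_bracket[of i j] e_bracket[of k l] by blast
  then show ?thesis by (simp add: metabelian)
qed

text \<open>ad x and ad y commute on commutators: by the Leibniz rule they differ by [[y, x], e], a
  bracket of two commutators. Hence one ordering of the operators suffices for the basis.\<close>

lemma br_y_e: "lbr L y (e i j) = e i (Suc j)"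
proof (induction i)
  case (Suc i)
  have "lbr L y (lbr L x (e i j)) = ladd L (lbr L (lbr L y x) (e i j)) (lbr L x (lbr L y (e i j)))"
    by (intro leibniz x_closed y_closed e_closed)
  moreover have "lbr L (lbr L y x) (e i j) = lzero L"
    using e_bracket[of i j] metabelian x_closed y_closed by metis
  ultimately show ?case
    using Suc x_closed e_closed[of i "Suc j"] by (simp add: zero_add closed)
qed simp

text \<open>Unfolded, \<open>e i j\<close> is a nested bracket with i + j + 1 outer entries around
  the innermost y.\<close>

lemma e_vanish:
  assumes "c \<le> i + j + 1"
  shows "e i j = lzero L"
proof -
  have "(lbr L u ^^ n) v = foldr (lbr L) (replicate n u) v" for u n v
    by (induction n) auto
  then have "e i j = foldr (lbr L) (replicate i x @ replicate j y @ [x]) y"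
    by simp
  also have "\<dots> = lzero L"
    by (rule nilpotent) (use assms x_closed y_closed in auto)
  finally show ?thesis .
qed

lemma \<Phi>_outside: "u \<in> lcar L \<Longrightarrow> p \<notin> bidegrees c \<Longrightarrow> \<Phi> u p = 0"
  using \<Phi>_space[of u] unfolding coord_space_def by blast

lemma \<Phi>_zero: "\<Phi> (lzero L) = 0"
  using \<Phi>_scale[OF zero_closed, of 0] by (simp add: scale_zero fscale_def fun_eq_iff)

text \<open>On commutators, bracketing with x or y shifts coordinates by one in the first or second
  index.\<close>

lemma \<Phi>_e: "(i + 1, j + 1) \<in> bidegrees c \<Longrightarrow> \<Phi> (e i j) = unit_fun (i + 1, j + 1)"
proof (induction i)
  case 0
  then show ?case
  proof (induction j)
    case 0
    then show ?case
      by (auto simp: \<Phi>_br x_closed y_closed \<Phi>_x \<Phi>_y coord_br_def half_br_def unit_fun_def fun_eq_iff)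
  next
    case (Suc j)
    then have "\<Phi> (e 0 j) = unit_fun (1, j + 1)" by (auto simp: bidegrees_def)
    then have "\<Phi> (e 0 (Suc j)) = coord_br c (unit_fun (0, 1)) (unit_fun (1, j + 1))"
      using e_closed[of 0 j] by (simp add: \<Phi>_br y_closed \<Phi>_y)
    also have "\<dots> = unit_fun (1, Suc j + 1)"
      using Suc.prems by (auto simp: coord_br_def half_br_def unit_fun_def fun_eq_iff)
    finally show ?case by simp
  qed
next
  case (Suc i)
  then have "\<Phi> (e i j) = unit_fun (i + 1, j + 1)" by (auto simp: bidegrees_def)
  then have "\<Phi> (e (Suc i) j) = coord_br c (unit_fun (1, 0)) (unit_fun (i + 1, j + 1))"
    using e_closed[of i j] by (simp add: \<Phi>_br x_closed \<Phi>_x)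
  also have "\<dots> = unit_fun (Suc i + 1, j + 1)"
    using Suc.prems by (auto simp: coord_br_def half_br_def unit_fun_def fun_eq_iff)
  finally show ?case by simp
qed

lemma \<Phi>_basis:
  assumes "p \<in> bidegrees c"
  shows "\<Phi> (basis p) = unit_fun p"
proof -
  obtain i j where p: "p = (i, j)" by force
  consider "p = (1, 0)" | "p = (0, 1)" | k l where "i = k + 1" "j = l + 1"
    using assms p by (auto simp: bidegrees_def) (metis Suc_le_D)
  then show ?thesis
    using assms p by cases (simp_all add: basis_def \<Phi>_x \<Phi>_y \<Phi>_e)
qed

text \<open>Since x and y generate, it is enough that the span is closed under the bracket, which by
  bilinearity concerns pairs of basis vectors only.\<close>

lemma lspan_basis: "lcar L \<subseteq> lspan L (basis ` bidegrees c)" (is "_ \<subseteq> ?H")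
proof (rule generated)
  have sub: "?H \<subseteq> lcar L" by (rule lspan_subset) (auto simp: basis_closed)
  have base: "basis p \<in> ?H" if "p \<in> bidegrees c" for p
    using that by (auto intro: lspan.base)
  show "x \<in> ?H" "y \<in> ?H"
    using base[of "(1, 0)"] base[of "(0, 1)"] by (simp_all add: basis_def bidegrees_def)
  \<comment> \<open>Arbitrary exponents are allowed, so that shifting a vector at the edge of
    \<open>bidegrees\<close> needs no special case.\<close>
  have e: "e i j \<in> ?H" for i j
  proof (cases "c \<le> i + j + 1")
    case True
    then show ?thesis by (simp add: e_vanish lspan.zero)
  next
    case False
    then show ?thesis using base[of "(i + 1, j + 1)"] by (simp add: basis_def bidegrees_def)
  qed
  have anti: "lbr L v u \<in> ?H" if "lbr L u v \<in> ?H" "u \<in> lcar L" "v \<in> lcar L" for u v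
    using br_anti[of v u] that by (simp add: lspan.scale)
  have cases_basis: "basis p \<in> {x, y} \<union> {e i j | i j. True}" for p
    by (auto simp: basis_def split: prod.split)
  have xy: "lbr L x y \<in> ?H" using e[of 0 0] by simp
  have xe: "lbr L x (e i j) \<in> ?H" for i j using e[of "Suc i" j] by simp
  have ye: "lbr L y (e i j) \<in> ?H" for i j using e[of i "Suc j"] by (simp add: br_y_e)
  have ee: "lbr L (e i j) (e k l) \<in> ?H" for i j k l by (simp add: br_e_e lspan.zero)
  have pair: "lbr L (basis p) (basis q) \<in> ?H" for p q
    using cases_basis[of p] cases_basis[of q]
    by (auto simp: br_self x_closed y_closed e_closed lspan.zero xy xe ye ee
        anti[OF xy] anti[OF xe] anti[OF ye])
  have left: "lbr L (basis p) v \<in> ?H" if "v \<in> ?H" for p v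
    using that
  proof induction
    case zero
    then show ?case by (simp add: br_zero basis_closed lspan.zero)
  next
    case (base v)
    then obtain q where "v = basis q" by blast
    then show ?case using pair by simp
  next
    case (add u v)
    then have "u \<in> lcar L" "v \<in> lcar L" using sub by auto
    then show ?case using add by (simp add: br_add basis_closed lspan.add)
  next
    case (scale u a)
    then have "u \<in> lcar L" using sub by auto
    then show ?case using scale by (simp add: br_scale basis_closed lspan.scale)
  qed
  show "lbr L u v \<in> ?H" if "u \<in> ?H" "v \<in> ?H" for u v
    using that(1)
  proof induction
    case zero
    have "v \<in> lcar L" using that sub by blast
    then show ?case by (simp add: zero_br lspan.zero)
  next
    case (base u)
    then obtain p where "u = basis p" by blast
    then show ?case using left[OF that(2)] by simp
  next
    case (add u w)
    then have "u \<in> lcar L" "w \<in> lcar L" "v \<in> lcar L" using that sub by auto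
    then show ?case using add by (simp add: add_br lspan.add)
  next
    case (scale u a)
    then have "u \<in> lcar L" "v \<in> lcar L" using that sub by auto
    then show ?case using scale by (simp add: scale_br lspan.scale)
  qed
qed (auto intro: lspan.intros)

lemma lin_map_\<Phi>: "lin_map_on L (lcar L) \<Phi>"
  by (simp add: lin_map_on_def closed \<Phi>_add \<Phi>_scale \<Phi>_zero)

text \<open>\<open>N\<close> recombines coordinates with the basis. It undoes \<open>\<Phi>\<close>
  because the basis spans, which gives injectivity; \<open>\<Phi>\<close> undoes \<open>N\<close>
  because basis vectors have unit coordinates, which gives surjectivity.\<close>

lemma \<Phi>_inj_surj:
  shows \<Phi>_inj: "u \<in> lcar L \<Longrightarrow> v \<in> lcar L \<Longrightarrow> \<Phi> u = \<Phi> v \<Longrightarrow> u = v"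
    and \<Phi>_surj: "w \<in> coord_space (bidegrees c) \<Longrightarrow> \<exists>u\<in>lcar L. \<Phi> u = w"
proof -
  obtain ps where ps: "set ps = bidegrees c" "distinct ps"
    using finite_distinct_list[OF finite_bidegrees] by blast
  define N where "N w = lcomb L (map w ps) (map basis ps)" for w
  have sub: "set (map basis ps) \<subseteq> lcar L" by (auto simp: basis_closed)
  have expand: "u = N (\<Phi> u)" if "u \<in> lcar L" for u
  proof -
    have "u \<in> lspan L (basis ` bidegrees c)" using that lspan_basis by blast
    then have "u \<in> lcar L \<and> u = N (\<Phi> u)"
    proof induction
      case zero
      have "N 0 = lzero L" unfolding N_def by (rule lcomb_zero) (auto simp: basis_closed)
      then show ?case by (simp add: \<Phi>_zero zero_closed zero_fun_def)
    next
      case (base u)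
      then obtain p where p: "p \<in> bidegrees c" "u = basis p" by blast
      have "N (unit_fun p) = basis p"
        unfolding N_def unit_fun_def by (rule lcomb_single) (use ps p in \<open>auto simp: basis_closed\<close>)
      then show ?case using p by (simp add: \<Phi>_basis basis_closed)
    next
      case (add u v)
      have "N (\<Phi> u + \<Phi> v) = ladd L (N (\<Phi> u)) (N (\<Phi> v))"
        using lcomb_add[OF sub, of "\<Phi> u" "\<Phi> v"] by (simp add: N_def plus_fun_def)
      then show ?case using add by (simp add: \<Phi>_add closed plus_fun_def)
    next
      case (scale u a)
      have "N (fscale a (\<Phi> u)) = lscale L a (N (\<Phi> u))"
        using lcomb_scale[OF sub, of a "\<Phi> u"] by (simp add: N_def fscale_def)
      then show ?case using scale by (simp add: \<Phi>_scale closed)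
    qed
    then show ?thesis by blast
  qed
  show "u \<in> lcar L \<Longrightarrow> v \<in> lcar L \<Longrightarrow> \<Phi> u = \<Phi> v \<Longrightarrow> u = v"
    using expand[of u] expand[of v] by simp
  show "\<exists>u\<in>lcar L. \<Phi> u = w" if w: "w \<in> coord_space (bidegrees c)"
  proof
    show "N w \<in> lcar L" unfolding N_def by (rule lcomb_closed[OF sub])
    have "\<Phi> (N w) = (\<Sum>p\<leftarrow>ps. fscale (w p) (\<Phi> (basis p)))"
      using lin_map_on_lcomb[OF lin_map_\<Phi> sub, of "map w ps"]
      by (simp add: N_def zip_map_map zip_same_conv_map comp_def)
    also have "\<dots> = (\<Sum>p\<in>bidegrees c. fscale (w p) (unit_fun p))"
      using ps by (auto simp: sum_list_distinct_conv_sum_set \<Phi>_basis intro: sum.cong)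
    also have "\<dots> = w" using coord_space_expand[OF finite_bidegrees w] by simp
    finally show "\<Phi> (N w) = w" .
  qed
qed

text \<open>The coordinates in J already separate the elements of S, so S embeds into the functions
  supported on J.\<close>

lemma lin_indep_upper:
  assumes S: "S \<subseteq> lcar L" "lzero L \<in> S" "\<And>u v. u \<in> S \<Longrightarrow> v \<in> S \<Longrightarrow> ladd L u v \<in> S"
    "\<And>a u. u \<in> S \<Longrightarrow> lscale L a u \<in> S"
    and J: "J \<subseteq> bidegrees c" "\<And>u p. u \<in> S \<Longrightarrow> (\<And>q. q \<in> J \<Longrightarrow> \<Phi> u q = 0) \<Longrightarrow> p \<in> bidegrees c \<Longrightarrow> \<Phi> u p = 0"
    and vs: "lin_indep L vs" "set vs \<subseteq> S"
  shows "length vs \<le> card J"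
proof -
  have fin: "finite J" using J(1) finite_bidegrees finite_subset by blast
  let ?\<Psi> = "\<lambda>u p. if p \<in> J then \<Phi> u p else 0"
  have "length vs \<le> card (unit_fun ` J :: (nat \<times> nat \<Rightarrow> 'k) set)"
  proof (rule lin_indep_length_le[OF _ _ _ _ vs])
    show "lin_map_on L S ?\<Psi>"
      using S by (auto simp: lin_map_on_def \<Phi>_add \<Phi>_scale \<Phi>_zero fscale_def fun_eq_iff subset_iff)
    show "u = lzero L" if u: "u \<in> S" "?\<Psi> u = 0" for u
    proof (rule \<Phi>_inj)
      have J0: "\<Phi> u q = 0" if "q \<in> J" for q using fun_cong[OF u(2), of q] that by simp
      have "\<Phi> u p = 0" for p
      proof (cases "p \<in> bidegrees c")
        case True
        then show ?thesis using J(2)[OF u(1) J0] by blast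
      next
        case False
        then show ?thesis using \<Phi>_outside u(1) S(1) by blast
      qed
      then show "\<Phi> u = \<Phi> (lzero L)" by (simp add: \<Phi>_zero fun_eq_iff)
    qed (use u S in auto)
    show "?\<Psi> ` S \<subseteq> fs.span (unit_fun ` J)"
      by (rule subset_trans[OF _ coord_space_span[OF fin]]) (auto simp: coord_space_def)
  qed (use fin in simp)
  then show ?thesis by (simp add: card_unit_fun)
qed

lemma lin_indep_lower:
  assumes S: "S \<subseteq> lcar L" and J: "J \<subseteq> bidegrees c"
    and sup: "\<And>u. u \<in> lcar L \<Longrightarrow> (\<And>p. p \<in> bidegrees c - J \<Longrightarrow> \<Phi> u p = 0) \<Longrightarrow> u \<in> S"
  obtains vs where "lin_indep L vs" "set vs \<subseteq> S" "length vs = card J"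
proof -
  have fin: "finite J" using J finite_bidegrees finite_subset by blast
  have sub: "unit_fun ` J \<subseteq> \<Phi> ` S"
  proof
    fix v :: "nat \<times> nat \<Rightarrow> 'k" assume "v \<in> unit_fun ` J"
    then obtain p where p: "p \<in> J" "v = unit_fun p" by blast
    then have "v \<in> coord_space (bidegrees c)" using J by (auto intro: unit_fun_coord_space)
    then obtain u where u: "u \<in> lcar L" "\<Phi> u = v" using \<Phi>_surj by blast
    then have "u \<in> S" using p by (intro sup) (auto simp: unit_fun_def)
    then show "v \<in> \<Phi> ` S" using u by blast
  qed
  show ?thesis
    by (rule lin_indep_exists[OF lin_map_\<Phi> S _ independent_unit_fun[OF fin] sub])
      (use fin that in \<open>simp_all add: card_unit_fun\<close>)
qed

lemma lin_indep_total:
  assumes "lin_indep L vs"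
  shows "length vs \<le> card (bidegrees c)"
  by (rule lin_indep_upper[of "lcar L", OF _ _ _ _ _ _ assms])
    (use assms in \<open>auto simp: closed lin_indep_def\<close>)

lemma ldim_lower:
  assumes "lin_indep L vs" "set vs \<subseteq> S"
  shows "length vs \<le> ldim L S"
  by (rule ldim_ge[OF _ assms]) (rule lin_indep_total)

lemma ldim_lower_coords:
  assumes "S \<subseteq> lcar L" "J \<subseteq> bidegrees c"
    and "\<And>u. u \<in> lcar L \<Longrightarrow> (\<And>p. p \<in> bidegrees c - J \<Longrightarrow> \<Phi> u p = 0) \<Longrightarrow> u \<in> S"
  shows "card J \<le> ldim L S"
proof -
  obtain vs where "lin_indep L vs" "set vs \<subseteq> S" "length vs = card J"
    using lin_indep_lower[OF assms] .
  then show ?thesis using ldim_lower by metis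
qed

lemma dim_lie_eq: "dim_lie L = card (bidegrees c)"
proof -
  have "dim_lie L \<le> card (bidegrees c)"
    unfolding dim_lie_def by (rule ldim_le) (rule lin_indep_total)
  moreover have "card (bidegrees c) \<le> dim_lie L"
    unfolding dim_lie_def by (rule ldim_lower_coords) auto
  ultimately show ?thesis by simp
qed

lemma card_bidegrees_diff: "X \<subseteq> bidegrees c \<Longrightarrow> card (bidegrees c - X) = card (bidegrees c) - card X"
  by (simp add: card_Diff_subset finite_subset[OF _ finite_bidegrees])

section \<open>The index\<close>

text \<open>For v in the commutator ideal, [w, v] is a combination of [x, v] and [y, v]. So such a v
  stabilises l as soon as l([x, v]) = l([y, v]) = 0: two equations in codimension two.\<close>

lemma ldim_stab_ge:
  assumes l: "lin_fun L l"
  shows "card (bidegrees c) - 4 \<le> ldim L (stab L l)"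
proof -
  have l_add: "l (ladd L u v) = l u + l v" if "u \<in> lcar L" "v \<in> lcar L" for u v
    using l that by (simp add: lin_fun_def)
  have l_scale: "l (lscale L a u) = a * l u" if "u \<in> lcar L" for a u
    using l that by (simp add: lin_fun_def)
  \<comment> \<open>A chosen inverse of \<open>\<Phi>\<close>; injectivity of \<open>\<Phi>\<close>
    makes it linear.\<close>
  define g where "g w = (SOME u. u \<in> lcar L \<and> \<Phi> u = w)" for w
  have g: "g w \<in> lcar L" "\<Phi> (g w) = w" if "w \<in> coord_space (bidegrees c)" for w
    using someI_ex[of "\<lambda>u. u \<in> lcar L \<and> \<Phi> u = w"] \<Phi>_surj[OF that] unfolding g_def by blast+
  let ?J = "bidegrees c - {(1, 0), (0, 1)}"
  let ?C = "coord_space ?J :: (nat \<times> nat \<Rightarrow> 'k) set"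
  have C: "w \<in> coord_space (bidegrees c)" if "w \<in> ?C" for w
    using that by (auto simp: coord_space_def)
  have sum: "g (v + w) = ladd L (g v) (g w)" if "v \<in> ?C" "w \<in> ?C" for v w
  proof (rule \<Phi>_inj)
    have "v + w \<in> coord_space (bidegrees c)" using that by (auto simp: coord_space_def)
    then show "\<Phi> (g (v + w)) = \<Phi> (ladd L (g v) (g w))" "g (v + w) \<in> lcar L"
      using that g C by (simp_all add: \<Phi>_add)
  qed (use that g C closed in simp)
  have scale: "g (fscale a w) = lscale L a (g w)" if "w \<in> ?C" for a w
  proof (rule \<Phi>_inj)
    have "fscale a w \<in> coord_space (bidegrees c)" using that by (auto simp: coord_space_def fscale_def)
    then show "\<Phi> (g (fscale a w)) = \<Phi> (lscale L a (g w))" "g (fscale a w) \<in> lcar L"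
      using that g C by (simp_all add: \<Phi>_scale)
  qed (use that g C closed in simp)
  obtain B where B: "finite B" "\<not> fs.dependent B"
    "B \<subseteq> {v\<in>?C. l (lbr L x (g v)) = 0 \<and> l (lbr L y (g v)) = 0}" "card ?J \<le> card B + 2"
    by (rule independent_in_kernels[of ?J "\<lambda>v. l (lbr L x (g v))" "\<lambda>v. l (lbr L y (g v))"])
      (auto simp: finite_bidegrees sum scale g C br_add br_scale l_add l_scale x_closed y_closed closed)
  have "B \<subseteq> \<Phi> ` stab L l"
  proof
    fix v assume "v \<in> B"
    then have v: "v \<in> ?C" "l (lbr L x (g v)) = 0" "l (lbr L y (g v)) = 0" using B(3) by auto
    have gv: "g v \<in> lcar L" "\<Phi> (g v) = v" using g C v by auto
    have v0: "v (1, 0) = 0" "v (0, 1) = 0" using v(1) by (auto simp: coord_space_def)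
    have "l (lbr L w (g v)) = 0" if w: "w \<in> lcar L" for w
    proof -
      \<comment> \<open>As v has no x or y coordinate, only those two coordinates of w enter the
        bracket.\<close>
      let ?r = "ladd L (lscale L (\<Phi> w (1, 0)) (lbr L x (g v))) (lscale L (\<Phi> w (0, 1)) (lbr L y (g v)))"
      have "lbr L w (g v) = ?r"
      proof (rule \<Phi>_inj)
        show "\<Phi> (lbr L w (g v)) = \<Phi> ?r"
          using gv w v0 by (auto simp: \<Phi>_br \<Phi>_add \<Phi>_scale closed x_closed y_closed \<Phi>_x \<Phi>_y
              coord_br_def half_br_def unit_fun_def fscale_def fun_eq_iff)
      qed (use gv w closed x_closed y_closed in auto)
      then show ?thesis using gv v by (simp add: l_add l_scale closed x_closed y_closed)
    qed
    then have "g v \<in> stab L l" using gv by (simp add: stab_def)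
    then show "v \<in> \<Phi> ` stab L l" using gv by (metis imageI)
  qed
  moreover have "stab L l \<subseteq> lcar L" by (auto simp: stab_def)
  ultimately obtain vs where "lin_indep L vs" "set vs \<subseteq> stab L l" "length vs = card B"
    using lin_indep_exists[OF lin_map_\<Phi>] B by metis
  then have "card B \<le> ldim L (stab L l)" using ldim_lower by metis
  moreover have "card ?J = card (bidegrees c) - 2"
    by (subst card_bidegrees_diff) (auto simp: bidegrees_def)
  ultimately show ?thesis using B(4) by simp
qed

lemma lie_index_eq:
  assumes c: "c \<ge> 4"
  shows "lie_index L = card (bidegrees c) - 4"
  unfolding lie_index_def
proof (rule Least_equality)
  let ?X = "{(1, 0), (0, 1), (2, 1), (1, 2)} :: (nat \<times> nat) set"
  \<comment> \<open>[x, e_21] is seen at (3, 1) and [y, e_12] at (1, 3). The cross brackets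
    [y, e_21] and [x, e_12] land at (2, 2), which \<open>l\<close> ignores, so the two pairs stay
    separate.\<close>
  define l where "l u = \<Phi> u (3, 1) + \<Phi> u (1, 3)" for u
  have lin: "lin_fun L l"
    by (simp add: lin_fun_def l_def \<Phi>_add \<Phi>_scale fscale_def algebra_simps)
  have X: "?X \<subseteq> bidegrees c" using c by (auto simp: bidegrees_def)
  have form: "l (lbr L u v) = \<Phi> u (1, 0) * \<Phi> v (2, 1) + \<Phi> u (0, 1) * \<Phi> v (1, 2)
      - \<Phi> v (1, 0) * \<Phi> u (2, 1) - \<Phi> v (0, 1) * \<Phi> u (1, 2)" if uv: "u \<in> lcar L" "v \<in> lcar L" for u v
  proof -
    \<comment> \<open>The (1, 3) coordinate of a bracket formally contains the slot (0, 3), which is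
      not a bidegree.\<close>
    have "\<Phi> u (0, 3) = 0" "\<Phi> v (0, 3) = 0"
      using \<Phi>_outside[OF uv(1)] \<Phi>_outside[OF uv(2)] by (auto simp: bidegrees_def)
    moreover have "(3, 1) \<in> bidegrees c" "(1, 3) \<in> bidegrees c"
      using c by (auto simp: bidegrees_def)
    ultimately show ?thesis using uv by (simp add: l_def \<Phi>_br coord_br_def half_br_def)
  qed
  have stab: "stab L l = {u \<in> lcar L. \<forall>p\<in>?X. \<Phi> u p = 0}"
  proof (intro equalityI subsetI)
    fix u assume "u \<in> stab L l"
    then have u: "u \<in> lcar L" "\<And>w. w \<in> lcar L \<Longrightarrow> l (lbr L w u) = 0" by (auto simp: stab_def)
    \<comment> \<open>Testing against the four basis vectors at \<open>?X\<close> suffices, because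
      the form is nondegenerate on their span.\<close>
    have "unit_fun p (1, 0) * \<Phi> u (2, 1) + unit_fun p (0, 1) * \<Phi> u (1, 2)
      - \<Phi> u (1, 0) * unit_fun p (2, 1) - \<Phi> u (0, 1) * unit_fun p (1, 2) = 0" if "p \<in> ?X" for p
      using u(2)[OF basis_closed, of p] form[OF basis_closed u(1), of p] \<Phi>_basis[of p] that X by auto
    from this[of "(1, 0)"] this[of "(0, 1)"] this[of "(2, 1)"] this[of "(1, 2)"]
    show "u \<in> {u \<in> lcar L. \<forall>p\<in>?X. \<Phi> u p = 0}"
      using u(1) by (simp add: unit_fun_def)
  next
    fix u assume "u \<in> {u \<in> lcar L. \<forall>p\<in>?X. \<Phi> u p = 0}"
    then show "u \<in> stab L l" by (auto simp: stab_def form)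
  qed
  have card: "card (bidegrees c - ?X) = card (bidegrees c) - 4"
    by (subst card_bidegrees_diff[OF X]) simp
  have "ldim L (stab L l) \<le> card (bidegrees c - ?X)"
  proof (rule ldim_le)
    fix vs assume "lin_indep L vs" "set vs \<subseteq> stab L l"
    then show "length vs \<le> card (bidegrees c - ?X)"
      unfolding stab
      by (intro lin_indep_upper[of "{u \<in> lcar L. \<forall>p\<in>?X. \<Phi> u p = 0}"])
        (auto simp: closed \<Phi>_add \<Phi>_scale \<Phi>_zero fscale_def)
  qed
  then have "ldim L (stab L l) = card (bidegrees c) - 4"
    using ldim_stab_ge[OF lin] card by simp
  then show "\<exists>l. lin_fun L l \<and> card (bidegrees c) - 4 = ldim L (stab L l)"
    using lin by metis
  show "card (bidegrees c) - 4 \<le> d" if "\<exists>l. lin_fun L l \<and> d = ldim L (stab L l)" for d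
    using that ldim_stab_ge by blast
qed

section \<open>Abelian subalgebras\<close>

lemma abelian_length_le:
  assumes c: "c \<ge> 4" and A: "abelian_subalg L A" and vs: "lin_indep L vs" "set vs \<subseteq> A"
  shows "length vs \<le> card (bidegrees c) - 2"
proof -
  have AL: "A \<subseteq> lcar L" and ab: "\<And>u v. u \<in> A \<Longrightarrow> v \<in> A \<Longrightarrow> lbr L u v = lzero L"
    using A by (auto simp: abelian_subalg_def)
  \<comment> \<open>If the vanishing of coordinate r forces p and q to vanish on A, then the
    coordinates other than p and q separate the elements of A.\<close>
  have bound: "length vs \<le> card (bidegrees c) - 2"
    if X: "{p, q} \<subseteq> bidegrees c" "p \<noteq> q" and r: "r \<in> bidegrees c - {p, q}"
      and pq: "\<And>u. u \<in> A \<Longrightarrow> \<Phi> u r = 0 \<Longrightarrow> \<Phi> u p = 0 \<and> \<Phi> u q = 0" for p q r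
  proof -
    have "length vs \<le> card (bidegrees c - {p, q})"
    proof (rule lin_indep_upper[OF AL _ _ _ _ _ vs])
      fix u s assume u: "u \<in> A" "\<And>t. t \<in> bidegrees c - {p, q} \<Longrightarrow> \<Phi> u t = 0" "s \<in> bidegrees c"
      then show "\<Phi> u s = 0" using pq[OF u(1) u(2)[OF r]] by (cases "s = p \<or> s = q") auto
    qed (use A in \<open>auto simp: abelian_subalg_def\<close>)
    then show ?thesis using card_bidegrees_diff[OF X(1)] X(2) by simp
  qed
  have mem: "(1, 0) \<in> bidegrees c" "(0, 1) \<in> bidegrees c" "(1, 1) \<in> bidegrees c"
    "(2, 1) \<in> bidegrees c" "(1, 2) \<in> bidegrees c"
    using c by (auto simp: bidegrees_def)
  \<comment> \<open>These are the (1, 1), (2, 1) and (1, 2) coordinates of [u, v] = 0.\<close>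
  have eqs: "\<Phi> u (1, 0) * \<Phi> v (0, 1) = \<Phi> v (1, 0) * \<Phi> u (0, 1)"
    "\<Phi> u (1, 0) * \<Phi> v (1, 1) = \<Phi> v (1, 0) * \<Phi> u (1, 1)"
    "\<Phi> u (0, 1) * \<Phi> v (1, 1) = \<Phi> v (0, 1) * \<Phi> u (1, 1)" if "u \<in> A" "v \<in> A" for u v
  proof -
    have uv: "u \<in> lcar L" "v \<in> lcar L" using that AL by auto
    have br: "coord_br c (\<Phi> u) (\<Phi> v) p = 0" for p
      using \<Phi>_br[OF uv] ab[OF that] by (simp add: \<Phi>_zero)
    have "\<Phi> u (0, 2) = 0" "\<Phi> v (0, 2) = 0"
      using \<Phi>_outside[OF uv(1)] \<Phi>_outside[OF uv(2)] by (auto simp: bidegrees_def)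
    then show "\<Phi> u (1, 0) * \<Phi> v (0, 1) = \<Phi> v (1, 0) * \<Phi> u (0, 1)"
      "\<Phi> u (1, 0) * \<Phi> v (1, 1) = \<Phi> v (1, 0) * \<Phi> u (1, 1)"
      "\<Phi> u (0, 1) * \<Phi> v (1, 1) = \<Phi> v (0, 1) * \<Phi> u (1, 1)"
      using br[of "(1, 1)"] br[of "(2, 1)"] br[of "(1, 2)"] mem
      by (simp_all add: coord_br_def half_br_def)
  qed
  show ?thesis
  proof (cases "\<exists>u\<in>A. \<Phi> u (1, 0) \<noteq> 0")
    case True
    then obtain u where u: "u \<in> A" "\<Phi> u (1, 0) \<noteq> 0" by blast
    \<comment> \<open>With u fixed, the (0, 1) and (1, 1) coordinates of v are fixed multiples of
      its (1, 0) coordinate.\<close>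
    have "\<Phi> v (0, 1) = 0 \<and> \<Phi> v (1, 1) = 0" if "v \<in> A" "\<Phi> v (1, 0) = 0" for v
      using eqs(1,2)[OF u(1) that(1)] that(2) u(2) by simp
    then show ?thesis
      by (intro bound[of "(0, 1)" "(1, 1)" "(1, 0)"]) (use mem in auto)
  next
    case False
    then have no_x: "\<Phi> u (1, 0) = 0" if "u \<in> A" for u using that by blast
    show ?thesis
    proof (cases "\<exists>u\<in>A. \<Phi> u (0, 1) \<noteq> 0")
      case True
      then obtain u where u: "u \<in> A" "\<Phi> u (0, 1) \<noteq> 0" by blast
      have "\<Phi> v (1, 0) = 0 \<and> \<Phi> v (1, 1) = 0" if "v \<in> A" "\<Phi> v (0, 1) = 0" for v
        using eqs(3)[OF u(1) that(1)] that(2) u(2) no_x[OF that(1)] by simp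
      then show ?thesis
        by (intro bound[of "(1, 0)" "(1, 1)" "(0, 1)"]) (use mem in auto)
    next
      case False
      \<comment> \<open>Here A lies in the commutator ideal: both coordinates vanish outright, and
        (1, 1) is just a third index.\<close>
      then show ?thesis
        by (intro bound[of "(1, 0)" "(0, 1)" "(1, 1)"]) (use mem no_x in auto)
    qed
  qed
qed

lemma alpha_eq:
  assumes c: "c \<ge> 4"
  shows "alpha L = card (bidegrees c) - 2"
  unfolding alpha_def
proof (rule Greatest_equality)
  have upper: "ldim L A \<le> card (bidegrees c) - 2" if "abelian_subalg L A" for A
    using abelian_length_le[OF c that] by (rule ldim_le)
  then show "d \<le> card (bidegrees c) - 2" if "\<exists>A. abelian_subalg L A \<and> d = ldim L A" for d
    using that by blast
  \<comment> \<open>The commutator ideal attains the bound.\<close>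
  define A where "A = {u \<in> lcar L. \<Phi> u (1, 0) = 0 \<and> \<Phi> u (0, 1) = 0}"
  have "lbr L u v = lzero L" if "u \<in> A" "v \<in> A" for u v
    by (rule \<Phi>_inj) (use that in \<open>auto simp: A_def closed \<Phi>_br \<Phi>_zero coord_br_def half_br_def fun_eq_iff\<close>)
  then have ab: "abelian_subalg L A"
    by (auto simp: abelian_subalg_def A_def closed \<Phi>_add \<Phi>_scale \<Phi>_zero fscale_def)
  have "card (bidegrees c - {(1, 0), (0, 1)}) \<le> ldim L A"
    by (rule ldim_lower_coords) (auto simp: A_def bidegrees_def)
  moreover have "card (bidegrees c - {(1, 0), (0, 1)}) = card (bidegrees c) - 2"
    by (subst card_bidegrees_diff) (auto simp: bidegrees_def)
  ultimately have "ldim L A = card (bidegrees c) - 2" using upper[OF ab] by simp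
  then show "\<exists>A. abelian_subalg L A \<and> card (bidegrees c) - 2 = ldim L A"
    using ab by metis
qed

end

section \<open>The two-generator algebra as an instance\<close>

lemma gen_letter: "gen i [k] = (if k = i then 1 else 0)"
  by (simp add: gen_def)

lemma dsum_gen: "dsum (gen i) a b = (if i = 1 \<and> a = 0 \<and> b = 0 then 1 else 0)"
proof (cases "a = 0 \<and> b = 0")
  case True
  then show ?thesis by (auto simp: dsum_0_0 gen_def)
next
  case False
  have "w \<noteq> []" if "w \<in> words a b" for w using length_words[OF that] False by auto
  then show ?thesis using False by (auto simp: dsum_def wsum_def gen_def intro!: sum.neutral)
qed

lemma coords_gen: "coords c (gen 0) = unit_fun (1, 0)" "coords c (gen 1) = unit_fun (0, 1)"
  by (auto simp: coords_def dsum_gen unit_fun_def bidegrees_def gen_letter fun_eq_iff)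

lemma metabelian_coords_Mgc:
  fixes G :: "('k::field, 'k ncpoly set set) lie"
  assumes "c \<ge> 1" "G = Mgc 2 c"
  obtains x y \<Phi> where "metabelian_coords G c x y \<Phi>"
proof -
  obtain \<pi> \<Phi> where G: "lie_alg G" and epi: "lie_epi (F 2) G \<pi>"
    and \<Phi>: "\<And>f. f \<in> freeLie_set 2 \<Longrightarrow> \<Phi> (\<pi> f) = coords c f"
    and metab: "\<And>u v w z. \<lbrakk>u \<in> lcar G; v \<in> lcar G; w \<in> lcar G; z \<in> lcar G\<rbrakk> \<Longrightarrow>
        lbr G (lbr G u v) (lbr G w z) = lzero G"
    and nil: "\<And>us v. \<lbrakk>set us \<subseteq> lcar G; v \<in> lcar G; c \<le> length us\<rbrakk> \<Longrightarrow> foldr (lbr G) us v = lzero G"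
    by (rule Mgc_structure[OF assms]) (rule that)
  interpret lie_alg G by (rule G)
  have car: "lcar G = \<pi> ` freeLie_set 2" and zero: "\<pi> (\<lambda>_. 0) = lzero G"
    using epi by (simp_all add: lie_epi_def F_def)
  have hom: "ladd G (\<pi> f) (\<pi> h) = \<pi> (\<lambda>w. f w + h w)"
    "lscale G a (\<pi> f) = \<pi> (\<lambda>w. a * f w)" "lbr G (\<pi> f) (\<pi> h) = \<pi> (ncbr f h)"
    if "f \<in> freeLie_set 2" "h \<in> freeLie_set 2" for a f h
    using epi that by (simp_all add: lie_epi_def F_def)
  have gens: "gen 0 \<in> freeLie_set 2" "gen 1 \<in> freeLie_set 2"
    by (auto intro: freeLie_set.gen)
  have "metabelian_coords G c (\<pi> (gen 0)) (\<pi> (gen 1)) \<Phi>"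
  proof unfold_locales
    fix H assume H: "\<pi> (gen 0) \<in> H" "\<pi> (gen 1) \<in> H" "lzero G \<in> H"
      "\<And>u v. u \<in> H \<Longrightarrow> v \<in> H \<Longrightarrow> ladd G u v \<in> H"
      "\<And>a u. u \<in> H \<Longrightarrow> lscale G a u \<in> H" "\<And>u v. u \<in> H \<Longrightarrow> v \<in> H \<Longrightarrow> lbr G u v \<in> H"
    have "\<pi> f \<in> H" if "f \<in> freeLie_set 2" for f
      using that
    proof induction
      case (gen i)
      then have "i = 0 \<or> i = 1" by auto
      then show ?case using H by auto
    next
      case (add f h)
      then show ?case using H(4) hom(1) by metis
    next
      case (scale f a)
      then show ?case using H(5) hom(2) by metis
    next
      case (br f h)
      then show ?case using H(6) hom(3) by metis
    qed (simp add: zero H)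
    then show "lcar G \<subseteq> H" by (auto simp: car)
  next
    show "\<Phi> (\<pi> (gen 0)) = unit_fun (1, 0)" "\<Phi> (\<pi> (gen 1)) = unit_fun (0, 1)"
      using \<Phi>[OF gens(1)] \<Phi>[OF gens(2)] by (simp_all only: coords_gen)
  qed (auto simp: car hom \<Phi> gens metab[unfolded car] nil[unfolded car] coords_add coords_scale coords_ncbr
      coords_space freeLie_set.intros)
  then show ?thesis by (rule that)
qed

theorem theorem5p4:
  fixes c :: nat and G :: "('k::field_char_0, 'k ncpoly set set) lie"
  assumes "alg_closed TYPE('k)"
    and "c \<ge> 4"
    and "G = Mgc 2 c"
  shows "int (lie_index G) = int (dim_lie G) - 4
       \<and> int (lie_index G) = 2 * int (alpha G) - int (dim_lie G)
       \<and> int (lie_index G) = (int c ^ 2 - int c - 4) div 2"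
proof -
  obtain x y \<Phi> where "metabelian_coords G c x y \<Phi>"
    using metabelian_coords_Mgc[OF _ assms(3)] assms(2) by fastforce
  then interpret metabelian_coords G c x y \<Phi> .
  obtain m where m: "c = Suc m" "m \<ge> 3" using assms(2) by (cases c) auto
  have n: "card (bidegrees c) = 2 + c * m div 2" using card_bidegrees[of c] m by simp
  have even: "2 * (c * m div 2) = c * m" using m by simp
  then have even': "2 * int (c * m div 2) = int (c * m)"
    by (metis of_nat_mult of_nat_numeral)
  \<comment> \<open>There are at least 8 bidegrees, so the natural-number subtractions of 4 and 2
    are exact.\<close>
  have big: "4 * 3 \<le> c * m" using assms(2) m(2) by (intro mult_mono) auto
  have "int c ^ 2 - int c - 4 = int (c * m) - 4" using m by (simp add: power2_eq_square algebra_simps)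
  also have "\<dots> = 2 * (int (c * m div 2) - 2)" using even' by simp
  finally have "(int c ^ 2 - int c - 4) div 2 = int (c * m div 2) - 2" by simp
  then show ?thesis
    using big even n by (simp add: lie_index_eq alpha_eq dim_lie_eq assms(2))
qed

end
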